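(* Let $n\ge 1$ be an integer and let $k$ be an algebraically closed field. Let $\mathcal{Z} = \mathbb{Z}[D, D_L, D_R, K_L, K_R, K]$, $\mathcal{A} = \mathbb{Z}[a^{\pm 1},b^{\pm 1},c^{\pm 1},d^{\pm 1},x^{\pm 1},y^{\pm 1},z^{\pm 1},w^{\pm 1}]$, and let $\theta:\mathcal{Z}\to\mathcal{A}$ be the ring homomorphism given in the context. Fix $\underline{\Pi} = (\delta,\delta_L,\delta_R,\kappa_L,\kappa_R,\kappa)\in k^6$ and let $\rho:\mathcal{Z}\to k$ be the unital ring homomorphism with $\rho(D)=\delta$, $\rho(D_L)=\delta_L$, $\rho(D_R)=\delta_R$, $\rho(K_L)=\kappa_L$, $\rho(K_R)=\kappa_R$, $\rho(K)=\kappa$. Then there exists $\underline{\Sigma} = (a_0,b_0,c_0,d_0,x_0,y_0,z_0,w_0)\in k^8$ with all entries non-zero such that the unital ring homomorphism $\iota:\mathcal{A}\to k$ with $a\mapsto a_0$, $b\mapsto b_0$, $c\mapsto c_0$, $d\mapsto d_0$, $x\mapsto x_0$, $y\mapsto y_0$, $z\mapsto z_0$, $w\mapsto w_0$ satisfies $\rho = \iota\circ\theta$, and the map $\mathcal{R}_{\underline{\Sigma}}$ defined in the context is a representation of $b_n^{\prime,k}(\underline{\Pi}) = k\otimes_{\mathcal{Z}} b'_n$ (with $k$ a $\mathcal{Z}$-algebra via $\rho$) on $\mathcal{V}(n) = k\otimes_{\mathcal{A}} V^{\otimes 4n}$.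
   Context: Symplectic blob algebra. For an integer $n \ge 1$, $b'_n$ is the associative unital algebra over $\mathcal{Z} = \mathbb{Z}[D, D_L, D_R, K_L, K_R, K]$ with generators $e, U_1,\ldots,U_{n-1}, f$ and relations (those involving a $U_i$ which does not exist being omitted): - $U_i^2 = D\,U_i$ for all $i$; - $U_iU_jU_i = U_i$ if $|i-j|=1$; - $U_iU_j = U_jU_i$ if $|i-j| \neq 1$; - $e^2 = D_L e$; $f^2 = D_R f$; - $U_1 e U_1 = K_L U_1$; $U_{n-1} f U_{n-1} = K_R U_{n-1}$; - $eU_i = U_i e$ if $i \neq 1$; $fU_i = U_i f$ if $i \neq n-1$; - $ef = fe$ if $n>1$; - $IJI = K I$ and $JIJ = K J$, where $I = U_1U_3\cdots U_{n-2} f$ and $J = e U_2 U_4\cdots U_{n-1}$ if $n$ is odd (for $n=1$: $I=f$, $J=e$), and $I = U_1U_3\cdots U_{n-1}$ and $J = eU_2U_4\cdots U_{n-2} f$ if $n$ is even (for $n=2$: $I=U_1$, $J=ef$). The homomorphism $\theta:\mathcal{Z}\to\mathcal{A}$ is the unital ring homomorphism with \begin{align*} \theta(D) &= \left(a+\tfrac1a\right)\left(b+\tfrac1b\right)\left(c+\tfrac1c\right)\left(d+\tfrac1d\right),\\ \theta(D_L) &= \left(x+\tfrac1x\right)\left(y+\tfrac1y\right),\\ \theta(D_R) &= \left(z+\tfrac1z\right)\left(w+\tfrac1w\right),\\ \theta(K_L) &= \left(\tfrac{ab}{x}+\tfrac{x}{ab}\right)\left(\tfrac{cd}{y}+\tfrac{y}{cd}\right),\\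 \theta(K_R) &= \left(\tfrac{ad}{w}+\tfrac{w}{ad}\right)\left(\tfrac{bc}{z}+\tfrac{z}{bc}\right), \end{align*} and $\theta(K) = \frac{xy}{zw}+2+\frac{zw}{xy}$ if $n$ is odd, $\theta(K) = \frac{abcd}{xyzw}+2+\frac{xyzw}{abcd}$ if $n$ is even. It makes $\mathcal{A}$ a $\mathcal{Z}$-algebra, and $b_n^{\prime,\mathcal{A}} := \mathcal{A}\otimes_{\mathcal{Z}} b'_n$. Operators. $V$ is the free $\mathcal{A}$-module with basis $\{v_1,v_2\}$. The tensor factors of $V^{\otimes 4n}$ (over $\mathcal{A}$) are indexed, left to right, by $I_n = \{-2n+1, -2n+2, \ldots, 2n\}$. It has a basis of elements $\underline{\alpha_{-2n+1}\cdots\alpha_{2n}} := v_{\alpha_{-2n+1}}\otimes\cdots\otimes v_{\alpha_{2n}}$ with $\alpha_j\in\{1,2\}$. For a unit $q \in \mathcal{A}^\times$ and $i \in I_n$, $R^q_i \in \mathrm{End}_{\mathcal{A}}(V^{\otimes 4n})$ is defined on basis elements $\alpha$ as follows. - For $i \neq 2n$: if $\alpha_i = \alpha_{i+1}$ then $R^q_i\alpha = 0$; otherwise $R^q_i \alpha = q^{2-\alpha_i}\,\underline{\cdots 12\cdots} + q^{1-\alpha_i}\,\underline{\cdots 21\cdots}$, the displayed entries being in positions $i,i+1$ and all others as in $\alpha$. - For $i=2n$: if $\alpha_{2n} = \alpha_{-2n+1}$ then $R^q_{2n}\alpha = 0$; otherwise $R^q_{2n}\alpha = q^{2-\alpha_{2n}}\,\underline{2\,\alpha_{-2n+2}\cdots\alpha_{2n-1}\,1}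 + q^{1-\alpha_{2n}}\,\underline{1\,\alpha_{-2n+2}\cdots\alpha_{2n-1}\,2}$. $\mathcal{R}: b_n^{\prime,\mathcal{A}}\to\mathrm{End}_{\mathcal{A}}(V^{\otimes 4n})$ denotes the representation determined by $\mathcal{R}(U_i) = R^a_{-n-i} R^b_{-n+i} R^c_{n-i} R^d_{n+i}$, $\mathcal{R}(e) = R^x_{-n} R^y_{n}$, $\mathcal{R}(f) = R^z_0 R^w_{2n}$. When $\rho=\iota\circ\theta$, regard $k$ as an $\mathcal{A}$-algebra via $\iota$, so that $b_n^{\prime,k}(\underline{\Pi}) = k\otimes_{\mathcal{A}} b_n^{\prime,\mathcal{A}}$. Then $\mathcal{R}_{\underline{\Sigma}} := \mathrm{id}_k\otimes_{\mathcal{A}}\mathcal{R} : b_n^{\prime,k}(\underline{\Pi})\to \mathrm{End}_k(\mathcal{V}(n))$, $\mathcal{V}(n) = k\otimes_{\mathcal{A}}V^{\otimes 4n}$, using the identification $k\otimes_{\mathcal{A}}\mathrm{End}_{\mathcal{A}}(V^{\otimes 4n}) = \mathrm{End}_k(k\otimes_{\mathcal{A}}V^{\otimes 4n})$. So $\mathcal{R}_{\underline{\Sigma}}$ sends generators to the same products of operators with $a,\ldots,w$ replaced by $a_0,\ldots,w_0$. A representation means a unital $k$-algebra homomorphism. *)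

theory Defs
  imports
    "HOL-Library.Poly_Mapping"
    "HOL-Library.FuncSet"
    "HOL-Computational_Algebra.Polynomial"
    "HOL-Algebra.QuotRing"
    "HOL-Algebra.Module"
begin

section \<open>Parameter rings\<close>

datatype param = PD | PDL | PDR | PKL | PKR | PK
datatype weight = Wa | Wb | Wc | Wd | Wx | Wy | Wz | Ww

text \<open>\<open>\<Z>[D, D\<^sub>L, D\<^sub>R, K\<^sub>L, K\<^sub>R, K]\<close> as the monoid ring of \<open>\<nat>\<^sup>6\<close>, and
  \<open>\<Z>[a\<^sup>\<plusminus>, \<dots>, w\<^sup>\<plusminus>]\<close> as the group ring of \<open>\<Z>\<^sup>8\<close>: the inner finitely supported
  map of a key is the exponent vector of a monomial.\<close>

type_synonym param_ring = "(param \<Rightarrow>\<^sub>0 nat) \<Rightarrow>\<^sub>0 int"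
type_synonym weight_ring = "(weight \<Rightarrow>\<^sub>0 int) \<Rightarrow>\<^sub>0 int"

definition param_var :: "param \<Rightarrow> param_ring" where
  "param_var v = Poly_Mapping.single (Poly_Mapping.single v 1) 1"

definition weight_var :: "weight \<Rightarrow> weight_ring" where
  "weight_var v = Poly_Mapping.single (Poly_Mapping.single v 1) 1"

definition weight_inv :: "weight \<Rightarrow> weight_ring" where
  "weight_inv v = Poly_Mapping.single (Poly_Mapping.single v (- 1)) 1"

text \<open>The unital ring homomorphisms out of these rings that send each variable \<open>v\<close> to
  \<open>s v\<close>; in the Laurent case the values \<open>s v\<close> have to be non-zero.\<close>

definition param_eval :: "(param \<Rightarrow> 'r) \<Rightarrow> param_ring \<Rightarrow> 'r::comm_ring_1" where
  "param_eval s p =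
     (\<Sum>m\<in>Poly_Mapping.keys p. of_int (Poly_Mapping.lookup p m) *
        (\<Prod>v\<in>Poly_Mapping.keys m. s v ^ Poly_Mapping.lookup m v))"

definition weight_eval :: "(weight \<Rightarrow> 'k) \<Rightarrow> weight_ring \<Rightarrow> 'k::field" where
  "weight_eval s p =
     (\<Sum>m\<in>Poly_Mapping.keys p. of_int (Poly_Mapping.lookup p m) *
        (\<Prod>v\<in>Poly_Mapping.keys m. s v powi Poly_Mapping.lookup m v))"

fun theta_val :: "nat \<Rightarrow> param \<Rightarrow> weight_ring" where
  "theta_val n PD =
     (weight_var Wa + weight_inv Wa) * (weight_var Wb + weight_inv Wb) *
     (weight_var Wc + weight_inv Wc) * (weight_var Wd + weight_inv Wd)"
| "theta_val n PDL = (weight_var Wx + weight_inv Wx) * (weight_var Wy + weight_inv Wy)"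
| "theta_val n PDR = (weight_var Wz + weight_inv Wz) * (weight_var Ww + weight_inv Ww)"
| "theta_val n PKL =
     (weight_var Wa * weight_var Wb * weight_inv Wx + weight_var Wx * weight_inv Wa * weight_inv Wb) *
     (weight_var Wc * weight_var Wd * weight_inv Wy + weight_var Wy * weight_inv Wc * weight_inv Wd)"
| "theta_val n PKR =
     (weight_var Wa * weight_var Wd * weight_inv Ww + weight_var Ww * weight_inv Wa * weight_inv Wd) *
     (weight_var Wb * weight_var Wc * weight_inv Wz + weight_var Wz * weight_inv Wb * weight_inv Wc)"
| "theta_val n PK =
     (if odd n then
        weight_var Wx * weight_var Wy * weight_inv Wz * weight_inv Ww + 2 +
        weight_var Wz * weight_var Ww * weight_inv Wx * weight_inv Wy
      else
        weight_var Wa * weight_var Wb * weight_var Wc * weight_var Wd *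
          weight_inv Wx * weight_inv Wy * weight_inv Wz * weight_inv Ww + 2 +
        weight_var Wx * weight_var Wy * weight_var Wz * weight_var Ww *
          weight_inv Wa * weight_inv Wb * weight_inv Wc * weight_inv Wd)"

definition theta :: "nat \<Rightarrow> param_ring \<Rightarrow> weight_ring" where
  "theta n = param_eval (theta_val n)"

section \<open>Algebras by generators and relations, and extension of scalars\<close>

text \<open>Associative unital algebras over a commutative ring (given as a type) are represented by
  the record type \<open>module\<close>; the product need not be commutative.\<close>

definition scale :: "'r::comm_ring_1 \<Rightarrow> ('m \<Rightarrow>\<^sub>0 'r) \<Rightarrow> ('m \<Rightarrow>\<^sub>0 'r)" where
  "scale c = Poly_Mapping.map ((*) c)"

definition monoid_algebra ::
    "('m, 'x) monoid_scheme \<Rightarrow> ('r::comm_ring_1, 'm \<Rightarrow>\<^sub>0 'r) module" where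
  "monoid_algebra M =
     \<lparr>carrier = {p. Poly_Mapping.keys p \<subseteq> carrier M},
      mult = (\<lambda>p q. \<Sum>x\<in>Poly_Mapping.keys p. \<Sum>y\<in>Poly_Mapping.keys q.
                Poly_Mapping.single (x \<otimes>\<^bsub>M\<^esub> y) (Poly_Mapping.lookup p x * Poly_Mapping.lookup q y)),
      one = Poly_Mapping.single \<one>\<^bsub>M\<^esub> 1,
      zero = 0,
      add = (+),
      smult = scale\<rparr>"

definition free_monoid :: "'g set \<Rightarrow> 'g list monoid" where
  "free_monoid X = \<lparr>carrier = lists X, mult = (@), one = []\<rparr>"

definition free_algebra :: "'g set \<Rightarrow> ('r::comm_ring_1, 'g list \<Rightarrow>\<^sub>0 'r) module" where
  "free_algebra X = monoid_algebra (free_monoid X)"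

text \<open>Quotient by the two-sided ideal generated by \<open>S\<close> (\<open>genideal\<close> is two-sided).\<close>

definition quot_algebra :: "('r, 'a) module \<Rightarrow> 'a set \<Rightarrow> ('r, 'a set) module" where
  "quot_algebra A S =
     (let I = Idl\<^bsub>A\<^esub> S in
        ring.extend (A Quot I) (module.fields (\<lambda>c X. \<Union>x\<in>X. I +>\<^bsub>A\<^esub> (c \<odot>\<^bsub>A\<^esub> x))))"

definition mult_monoid :: "'k::comm_ring_1 monoid" where
  "mult_monoid = \<lparr>carrier = UNIV, mult = (*), one = 1\<rparr>"

text \<open>Extension of scalars \<open>'k \<otimes>\<^sub>Z B\<close> of a \<open>'z\<close>-algebra \<open>B\<close> along a ring homomorphism \<open>h\<close>.
  The free abelian group on \<open>'k \<times> B\<close> with product \<open>(s, b) (s', b') = (s s', b b')\<close> is divided by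
  the usual bilinearity and balancing relations; the subgroup generated by these is stable under
  multiplication, so it is the two-sided ideal they generate.\<close>

definition tensor_free :: "('z, 'b) module \<Rightarrow> (int, ('k::comm_ring_1 \<times> 'b) \<Rightarrow>\<^sub>0 int) module" where
  "tensor_free B = monoid_algebra (mult_monoid \<times>\<times> B)"

inductive_set tensor_relators ::
    "('z \<Rightarrow> 'k) \<Rightarrow> ('z, 'b) module \<Rightarrow> (('k::comm_ring_1 \<times> 'b) \<Rightarrow>\<^sub>0 int) set"
  for h :: "'z \<Rightarrow> 'k" and B :: "('z, 'b) module" where
  add_left: "b \<in> carrier B \<Longrightarrow>
     Poly_Mapping.single (s + s', b) 1 - Poly_Mapping.single (s, b) 1 - Poly_Mapping.single (s', b) 1
       \<in> tensor_relators h B"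
| add_right: "b \<in> carrier B \<Longrightarrow> b' \<in> carrier B \<Longrightarrow>
     Poly_Mapping.single (s, b \<oplus>\<^bsub>B\<^esub> b') 1 - Poly_Mapping.single (s, b) 1 - Poly_Mapping.single (s, b') 1
       \<in> tensor_relators h B"
| balanced: "b \<in> carrier B \<Longrightarrow>
     Poly_Mapping.single (s * h r, b) 1 - Poly_Mapping.single (s, r \<odot>\<^bsub>B\<^esub> b) 1
       \<in> tensor_relators h B"

definition tensor_ideal ::
    "('z \<Rightarrow> 'k) \<Rightarrow> ('z, 'b) module \<Rightarrow> (('k::comm_ring_1 \<times> 'b) \<Rightarrow>\<^sub>0 int) set" where
  "tensor_ideal h B = Idl\<^bsub>tensor_free B\<^esub> (tensor_relators h B)"

definition tensor_elem ::
    "('z \<Rightarrow> 'k) \<Rightarrow> ('z, 'b) module \<Rightarrow> 'k::comm_ring_1 \<Rightarrow> 'b \<Rightarrow> (('k \<times> 'b) \<Rightarrow>\<^sub>0 int) set" where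
  "tensor_elem h B s b = tensor_ideal h B +>\<^bsub>tensor_free B\<^esub> Poly_Mapping.single (s, b) 1"

definition scalar_extension ::
    "('z \<Rightarrow> 'k) \<Rightarrow> ('z, 'b) module \<Rightarrow> ('k::comm_ring_1, (('k \<times> 'b) \<Rightarrow>\<^sub>0 int) set) module" where
  "scalar_extension h B =
     (let Q = tensor_free B Quot tensor_ideal h B in
        ring.extend Q (module.fields (\<lambda>c X. tensor_elem h B c \<one>\<^bsub>B\<^esub> \<otimes>\<^bsub>Q\<^esub> X)))"

definition algebra_hom :: "('r, 'a) module \<Rightarrow> ('r, 'b) module \<Rightarrow> ('a \<Rightarrow> 'b) set" where
  "algebra_hom A B =
     {\<phi> \<in> ring_hom A B. \<forall>c. \<forall>x\<in>carrier A. \<phi> (c \<odot>\<^bsub>A\<^esub> x) = c \<odot>\<^bsub>B\<^esub> \<phi> x}"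

section \<open>The symplectic blob algebra\<close>

datatype blob_gen = Ge | GU nat | Gf

definition blob_gens :: "nat \<Rightarrow> blob_gen set" where
  "blob_gens n = {Ge, Gf} \<union> GU ` {1..<n}"

definition word_I :: "nat \<Rightarrow> blob_gen list" where
  "word_I n = map GU (filter odd [1..<n]) @ (if odd n then [Gf] else [])"

definition word_J :: "nat \<Rightarrow> blob_gen list" where
  "word_J n = [Ge] @ map GU (filter even [1..<n]) @ (if even n then [Gf] else [])"

text \<open>A triple \<open>(u, c, v)\<close> stands for the relation \<open>u = c v\<close> between words \<open>u\<close>, \<open>v\<close>.\<close>

inductive_set blob_relations :: "nat \<Rightarrow> (blob_gen list \<times> param_ring \<times> blob_gen list) set"
  for n :: nat where
  "i \<in> {1..<n} \<Longrightarrow> ([GU i, GU i], param_var PD, [GU i]) \<in> blob_relations n"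
| "i \<in> {1..<n} \<Longrightarrow> j \<in> {1..<n} \<Longrightarrow> \<bar>int i - int j\<bar> = 1 \<Longrightarrow>
     ([GU i, GU j, GU i], 1, [GU i]) \<in> blob_relations n"
| "i \<in> {1..<n} \<Longrightarrow> j \<in> {1..<n} \<Longrightarrow> \<bar>int i - int j\<bar> \<noteq> 1 \<Longrightarrow>
     ([GU i, GU j], 1, [GU j, GU i]) \<in> blob_relations n"
| "([Ge, Ge], param_var PDL, [Ge]) \<in> blob_relations n"
| "([Gf, Gf], param_var PDR, [Gf]) \<in> blob_relations n"
| "n > 1 \<Longrightarrow> ([GU 1, Ge, GU 1], param_var PKL, [GU 1]) \<in> blob_relations n"
| "n > 1 \<Longrightarrow> ([GU (n - 1), Gf, GU (n - 1)], param_var PKR, [GU (n - 1)]) \<in> blob_relations n"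
| "i \<in> {1..<n} \<Longrightarrow> i \<noteq> 1 \<Longrightarrow> ([Ge, GU i], 1, [GU i, Ge]) \<in> blob_relations n"
| "i \<in> {1..<n} \<Longrightarrow> i \<noteq> n - 1 \<Longrightarrow> ([Gf, GU i], 1, [GU i, Gf]) \<in> blob_relations n"
| "n > 1 \<Longrightarrow> ([Ge, Gf], 1, [Gf, Ge]) \<in> blob_relations n"
| "(word_I n @ word_J n @ word_I n, param_var PK, word_I n) \<in> blob_relations n"
| "(word_J n @ word_I n @ word_J n, param_var PK, word_J n) \<in> blob_relations n"

definition blob_relators :: "nat \<Rightarrow> (blob_gen list \<Rightarrow>\<^sub>0 param_ring) set" where
  "blob_relators n =
     (\<lambda>(u, c, v). Poly_Mapping.single u 1 - Poly_Mapping.single v c) ` blob_relations n"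

definition blob_algebra :: "nat \<Rightarrow> (param_ring, (blob_gen list \<Rightarrow>\<^sub>0 param_ring) set) module" where
  "blob_algebra n = quot_algebra (free_algebra (blob_gens n)) (blob_relators n)"

definition blob_elem :: "nat \<Rightarrow> blob_gen \<Rightarrow> (blob_gen list \<Rightarrow>\<^sub>0 param_ring) set" where
  "blob_elem n g =
     (let F = free_algebra (blob_gens n)
      in Idl\<^bsub>F\<^esub> (blob_relators n) +>\<^bsub>F\<^esub> Poly_Mapping.single [g] 1)"

section \<open>The operators on the tensor space\<close>

text \<open>The tensor space over \<open>'k\<close> is the free module on the basis vectors indexed by maps \<open>\<alpha>\<close>
  from the set of tensor positions to \<open>{1, 2}\<close>.\<close>

definition positions :: "nat \<Rightarrow> int set" where
  "positions n = {- 2 * int n + 1 .. 2 * int n}"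

definition basis_index :: "nat \<Rightarrow> (int \<Rightarrow> int) set" where
  "basis_index n = (\<Pi>\<^sub>E i\<in>positions n. {1, 2})"

definition tensor_space :: "nat \<Rightarrow> ((int \<Rightarrow> int) \<Rightarrow>\<^sub>0 'k::field) set" where
  "tensor_space n = {v. Poly_Mapping.keys v \<subseteq> basis_index n}"

definition End_space ::
    "nat \<Rightarrow> ('k::field, ((int \<Rightarrow> int) \<Rightarrow>\<^sub>0 'k) \<Rightarrow> ((int \<Rightarrow> int) \<Rightarrow>\<^sub>0 'k)) module" where
  "End_space n =
     \<lparr>carrier = {T \<in> tensor_space n \<rightarrow>\<^sub>E tensor_space n.
        (\<forall>u\<in>tensor_space n. \<forall>v\<in>tensor_space n. T (u + v) = T u + T v) \<and>
        (\<forall>c. \<forall>v\<in>tensor_space n. T (scale c v) = scale c (T v))},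
      mult = compose (tensor_space n),
      one = (\<lambda>v\<in>tensor_space n. v),
      zero = (\<lambda>v\<in>tensor_space n. 0),
      add = (\<lambda>S T. \<lambda>v\<in>tensor_space n. S v + T v),
      smult = (\<lambda>c T. \<lambda>v\<in>tensor_space n. scale c (T v))\<rparr>"

text \<open>The two cases \<open>i \<noteq> 2n\<close> and \<open>i = 2n\<close> of the operator are the same formula when the position
  after \<open>2n\<close> is read as \<open>-2n + 1\<close>.\<close>

definition next_pos :: "nat \<Rightarrow> int \<Rightarrow> int" where
  "next_pos n i = (if i = 2 * int n then - 2 * int n + 1 else i + 1)"

definition R_basis :: "nat \<Rightarrow> 'k::field \<Rightarrow> int \<Rightarrow> (int \<Rightarrow> int) \<Rightarrow> ((int \<Rightarrow> int) \<Rightarrow>\<^sub>0 'k)" where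
  "R_basis n q i \<alpha> =
     (let j = next_pos n i in
      if \<alpha> i = \<alpha> j then 0
      else Poly_Mapping.single (\<alpha>(i := 1, j := 2)) (q powi (2 - \<alpha> i)) +
           Poly_Mapping.single (\<alpha>(i := 2, j := 1)) (q powi (1 - \<alpha> i)))"

definition R_op ::
    "nat \<Rightarrow> 'k::field \<Rightarrow> int \<Rightarrow> ((int \<Rightarrow> int) \<Rightarrow>\<^sub>0 'k) \<Rightarrow> ((int \<Rightarrow> int) \<Rightarrow>\<^sub>0 'k)" where
  "R_op n q i =
     (\<lambda>v\<in>tensor_space n.
        \<Sum>\<alpha>\<in>Poly_Mapping.keys v. scale (Poly_Mapping.lookup v \<alpha>) (R_basis n q i \<alpha>))"

fun R_gen ::
    "nat \<Rightarrow> (weight \<Rightarrow> 'k::field) \<Rightarrow> blob_gen \<Rightarrow> ((int \<Rightarrow> int) \<Rightarrow>\<^sub>0 'k) \<Rightarrow> ((int \<Rightarrow> int) \<Rightarrow>\<^sub>0 'k)" where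
  "R_gen n s (GU i) =
     R_op n (s Wa) (- int n - int i) \<otimes>\<^bsub>End_space n\<^esub> R_op n (s Wb) (- int n + int i)
       \<otimes>\<^bsub>End_space n\<^esub> R_op n (s Wc) (int n - int i) \<otimes>\<^bsub>End_space n\<^esub> R_op n (s Wd) (int n + int i)"
| "R_gen n s Ge = R_op n (s Wx) (- int n) \<otimes>\<^bsub>End_space n\<^esub> R_op n (s Wy) (int n)"
| "R_gen n s Gf = R_op n (s Wz) 0 \<otimes>\<^bsub>End_space n\<^esub> R_op n (s Ww) (2 * int n)"

end

theory Submission
  imports Defs "HOL-Library.Multiset"
begin

text \<open>
  Weights: prescribe \<open>xy = u\<close>, \<open>zw = v\<close> and \<open>abcd = m\<close> so that the equation for \<open>K\<close> holds. Then \<open>x\<close>,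
  \<open>z\<close>, \<open>p = ab\<close> and \<open>r = ad\<close> are each a root of one Laurent polynomial whose extreme coefficients do
  not vanish, which settles \<open>D\<^sub>L\<close>, \<open>D\<^sub>R\<close>, \<open>K\<^sub>L\<close>, \<open>K\<^sub>R\<close>; given \<open>p\<close>, \<open>r\<close>, \<open>m\<close>, the equation for \<open>D\<close>
  becomes such a polynomial equation for \<open>a\<^sup>2\<close>.

  Operators: on coordinates every \<open>R\<close> is a rank one matrix acting on two neighbouring sites of a ring
  of \<open>4n\<close> sites. Most relations follow from commutation of disjoint operators and from
  computations on at most four sites. The operators \<open>I\<close> and \<open>J\<close> are the products over the two
  perfect matchings of the ring into neighbouring pairs, hence of rank one; their mutual pairings
  are sums over the two alternating configurations, which gives \<open>(1 + s) (1 + 1/s)\<close> with \<open>s\<close> the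
  quotient of the products of the weights.
\<close>

section \<open>Monoid algebras and their representations on the tensor space\<close>

text \<open>The algebra is given by generators and relations and then by a tensor product, so a
  homomorphism out of it has to descend through two quotients. Both are quotients of monoid
  algebras, and one linear extension of a monoid representation serves for both. The operators are
  built directly over \<open>'k\<close>; the Laurent ring enters only through evaluation at the
  weights, and the factorisation of \<open>\<rho>\<close> through \<open>theta n\<close> turns the
  constants found for the operators into those of the relations.

  The obstacle is that a generator acts at several places of the ring at once. For all relations
  except the two between I and J, the sites involved split into disjoint blocks; a relation on few
  sites holds in each block, and the constants of the blocks multiply. This is why the images of D,
  D_L, D_R, K_L and K_R under \<open>theta\<close> are products. Between I and J nothing splits:
  their pairs together close up to a single cycle through all sites, so that the argument has to
  treat the whole ring.\<close>

lemma lookup_scale [simp]: "Poly_Mapping.lookup (scale c p) x = c * Poly_Mapping.lookup p x"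
  by (simp add: scale_def Poly_Mapping.map.rep_eq when_def)

lemma scale_simps [simp]:
  "scale 0 p = 0" "scale 1 p = p" "scale c 0 = 0" "scale c (scale d p) = scale (c * d) p"
  "scale c (Poly_Mapping.single x a) = Poly_Mapping.single x (c * a)"
  by (auto intro!: poly_mapping_eqI simp: lookup_single when_def mult.assoc)

lemma scale_add: "scale c (p + q) = scale c p + scale c q" "scale (c + d) p = scale c p + scale d p"
  by (auto intro!: poly_mapping_eqI simp: lookup_add algebra_simps)

lemma scale_uminus: "scale (- c) p = - scale c p" "scale c (- p) = - scale c p"
  by (auto intro!: poly_mapping_eqI)

lemma scale_sum: "scale c (sum f A) = (\<Sum>x\<in>A. scale c (f x))"
  by (induction A rule: infinite_finite_induct) (simp_all add: scale_add)

lemma keys_scale: "Poly_Mapping.keys (scale c p) \<subseteq> Poly_Mapping.keys p"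
  by (auto simp: in_keys_iff)

lemma tensor_space_closed:
  "0 \<in> tensor_space n"
  "u \<in> tensor_space n \<Longrightarrow> v \<in> tensor_space n \<Longrightarrow> u + v \<in> tensor_space n"
  "v \<in> tensor_space n \<Longrightarrow> - v \<in> tensor_space n"
  "v \<in> tensor_space n \<Longrightarrow> scale c v \<in> tensor_space n"
  using Poly_Mapping.keys_add[of u v] keys_scale[of c v]
  by (auto simp: tensor_space_def in_keys_iff)

lemma tensor_space_sum:
  "(\<And>x. x \<in> A \<Longrightarrow> f x \<in> tensor_space n) \<Longrightarrow> sum f A \<in> tensor_space n"
  by (induction A rule: infinite_finite_induct) (simp_all add: tensor_space_closed)

lemma End_space_iff:
  "T \<in> carrier (End_space n) \<longleftrightarrow> T \<in> extensional (tensor_space n) \<and>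
     (\<forall>v\<in>tensor_space n. T v \<in> tensor_space n) \<and>
     (\<forall>u\<in>tensor_space n. \<forall>v\<in>tensor_space n. T (u + v) = T u + T v) \<and>
     (\<forall>c. \<forall>v\<in>tensor_space n. T (scale c v) = scale c (T v))"
  by (auto simp: End_space_def PiE_iff)

lemma End_space_simps:
  "S \<otimes>\<^bsub>End_space n\<^esub> T = compose (tensor_space n) S T"
  "\<one>\<^bsub>End_space n\<^esub> = (\<lambda>v\<in>tensor_space n. v)"
  "\<zero>\<^bsub>End_space n\<^esub> = (\<lambda>v\<in>tensor_space n. 0)"
  "S \<oplus>\<^bsub>End_space n\<^esub> T = (\<lambda>v\<in>tensor_space n. S v + T v)"
  "c \<odot>\<^bsub>End_space n\<^esub> T = (\<lambda>v\<in>tensor_space n. scale c (T v))"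
  by (simp_all add: End_space_def)

lemma End_space_sum:
  assumes "T \<in> carrier (End_space n)" "\<And>x. x \<in> A \<Longrightarrow> f x \<in> tensor_space n"
  shows "T (sum f A) = (\<Sum>x\<in>A. T (f x))"
proof -
  have "T 0 = T (scale 0 0)" by simp
  also have "\<dots> = 0" using assms(1) by (simp only: End_space_iff tensor_space_closed) simp
  finally have "T 0 = 0" .
  with assms show ?thesis
    by (induction A rule: infinite_finite_induct)
      (auto simp: End_space_iff tensor_space_sum)
qed

lemma End_space_eqI:
  assumes "S \<in> carrier (End_space n)" "T \<in> carrier (End_space n)"
    "\<And>v. v \<in> tensor_space n \<Longrightarrow> S v = T v"
  shows "S = T"
  using assms by (intro extensionalityI[of _ "tensor_space n"]) (auto simp: End_space_iff)

lemma End_space_const_closed: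
  "\<one>\<^bsub>End_space n\<^esub> \<in> carrier (End_space n)" "\<zero>\<^bsub>End_space n\<^esub> \<in> carrier (End_space n)"
  by (auto simp: End_space_iff End_space_simps tensor_space_closed)

lemma End_space_closed:
  assumes "T \<in> carrier (End_space n)"
  shows "S \<in> carrier (End_space n) \<Longrightarrow> S \<otimes>\<^bsub>End_space n\<^esub> T \<in> carrier (End_space n)"
    "S \<in> carrier (End_space n) \<Longrightarrow> S \<oplus>\<^bsub>End_space n\<^esub> T \<in> carrier (End_space n)"
    "c \<odot>\<^bsub>End_space n\<^esub> T \<in> carrier (End_space n)"
  using assms
  by (auto simp: End_space_iff End_space_simps tensor_space_closed compose_def scale_add mult_ac algebra_simps)

lemma ring_End_space: "ring (End_space n :: ('k::field, _) module)"
proof (rule ringI)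
  let ?E = "End_space n :: ('k::field, _) module"
  show "abelian_group ?E"
  proof (rule abelian_groupI)
    fix T assume T: "T \<in> carrier ?E"
    show "\<exists>S\<in>carrier ?E. S \<oplus>\<^bsub>?E\<^esub> T = \<zero>\<^bsub>?E\<^esub>"
    proof
      show "(-1) \<odot>\<^bsub>?E\<^esub> T \<in> carrier ?E" by (rule End_space_closed[OF T])
      show "(-1) \<odot>\<^bsub>?E\<^esub> T \<oplus>\<^bsub>?E\<^esub> T = \<zero>\<^bsub>?E\<^esub>"
        by (auto simp: End_space_simps fun_eq_iff restrict_def scale_uminus)
    qed
  next
    fix T assume T: "T \<in> carrier ?E"
    show "\<zero>\<^bsub>?E\<^esub> \<oplus>\<^bsub>?E\<^esub> T = T"
      by (rule End_space_eqI[OF End_space_closed(2)[OF T End_space_const_closed(2)] T])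
        (simp add: End_space_simps tensor_space_closed)
  qed (simp_all add: End_space_closed End_space_const_closed, auto simp: End_space_simps fun_eq_iff restrict_def add_ac)
  show "monoid ?E"
  proof (rule monoidI)
    fix S T U assume "S \<in> carrier ?E" "T \<in> carrier ?E" "U \<in> carrier ?E"
    then show "S \<otimes>\<^bsub>?E\<^esub> T \<otimes>\<^bsub>?E\<^esub> U = S \<otimes>\<^bsub>?E\<^esub> (T \<otimes>\<^bsub>?E\<^esub> U)"
      by (auto simp: End_space_simps End_space_iff compose_def fun_eq_iff)
  next
    fix T assume T: "T \<in> carrier ?E"
    show "\<one>\<^bsub>?E\<^esub> \<otimes>\<^bsub>?E\<^esub> T = T" 
      by (rule End_space_eqI[OF End_space_closed(1)[OF T End_space_const_closed(1)] T])
        (use T in \<open>simp add: End_space_simps compose_def End_space_iff\<close>)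
    show "T \<otimes>\<^bsub>?E\<^esub> \<one>\<^bsub>?E\<^esub> = T" 
      by (rule End_space_eqI[OF End_space_closed(1)[OF End_space_const_closed(1) T] T])
        (use T in \<open>simp add: End_space_simps compose_def End_space_iff\<close>)
  qed (simp_all add: End_space_closed End_space_const_closed)
  fix S T U assume "S \<in> carrier ?E" "T \<in> carrier ?E" "U \<in> carrier ?E"
  then show "(S \<oplus>\<^bsub>?E\<^esub> T) \<otimes>\<^bsub>?E\<^esub> U = S \<otimes>\<^bsub>?E\<^esub> U \<oplus>\<^bsub>?E\<^esub> T \<otimes>\<^bsub>?E\<^esub> U"
    "U \<otimes>\<^bsub>?E\<^esub> (S \<oplus>\<^bsub>?E\<^esub> T) = U \<otimes>\<^bsub>?E\<^esub> S \<oplus>\<^bsub>?E\<^esub> U \<otimes>\<^bsub>?E\<^esub> T"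
    by (auto simp: End_space_simps End_space_iff compose_def fun_eq_iff)
qed

section \<open>Monoid algebras as rings\<close>

lemma monoid_algebra_simps:
  "carrier (monoid_algebra M) = {p. Poly_Mapping.keys p \<subseteq> carrier M}"
  "\<one>\<^bsub>monoid_algebra M\<^esub> = Poly_Mapping.single \<one>\<^bsub>M\<^esub> 1"
  "\<zero>\<^bsub>monoid_algebra M\<^esub> = 0" "p \<oplus>\<^bsub>monoid_algebra M\<^esub> q = p + q"
  "c \<odot>\<^bsub>monoid_algebra M\<^esub> p = scale c p"
  by (simp_all add: monoid_algebra_def)

text \<open>Terms outside the supports carry coefficient 0. The freedom in \<open>A\<close> and
  \<open>B\<close> lets products of elements with different supports be expanded over common index
  sets, as distributivity requires.\<close>

lemma monoid_algebra_mult: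
  assumes "finite A" "finite B" "Poly_Mapping.keys p \<subseteq> A" "Poly_Mapping.keys q \<subseteq> B"
  shows "p \<otimes>\<^bsub>monoid_algebra M\<^esub> q = (\<Sum>x\<in>A. \<Sum>y\<in>B.
    Poly_Mapping.single (x \<otimes>\<^bsub>M\<^esub> y) (Poly_Mapping.lookup p x * Poly_Mapping.lookup q y))"
  unfolding monoid_algebra_def module.simps ring.simps monoid.simps
  by (subst sum.mono_neutral_left[of A], use assms in \<open>auto simp: in_keys_iff\<close>,
      rule sum.cong[OF refl], rule sum.mono_neutral_left, use assms in \<open>auto simp: in_keys_iff\<close>)

lemma monoid_algebra_distrib:
  "(p + q) \<otimes>\<^bsub>monoid_algebra M\<^esub> r = p \<otimes>\<^bsub>monoid_algebra M\<^esub> r + q \<otimes>\<^bsub>monoid_algebra M\<^esub> r"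
  "r \<otimes>\<^bsub>monoid_algebra M\<^esub> (p + q) = r \<otimes>\<^bsub>monoid_algebra M\<^esub> p + r \<otimes>\<^bsub>monoid_algebra M\<^esub> q"
proof -
  let ?A = "Poly_Mapping.keys p \<union> Poly_Mapping.keys q" and ?B = "Poly_Mapping.keys r"
  have fin: "finite ?A" "finite ?B" by auto
  note * = Poly_Mapping.keys_add[of p q]
  show "(p + q) \<otimes>\<^bsub>monoid_algebra M\<^esub> r = p \<otimes>\<^bsub>monoid_algebra M\<^esub> r + q \<otimes>\<^bsub>monoid_algebra M\<^esub> r"
    by (subst (1 2 3) monoid_algebra_mult[OF fin])
      (use * in \<open>auto simp: lookup_add ring_distribs single_add sum.distrib\<close>)
  show "r \<otimes>\<^bsub>monoid_algebra M\<^esub> (p + q) = r \<otimes>\<^bsub>monoid_algebra M\<^esub> p + r \<otimes>\<^bsub>monoid_algebra M\<^esub> q"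
    by (subst (1 2 3) monoid_algebra_mult[OF fin(2,1)])
      (use * in \<open>auto simp: lookup_add ring_distribs single_add sum.distrib\<close>)
qed

lemma monoid_algebra_zero_mult [simp]:
  "0 \<otimes>\<^bsub>monoid_algebra M\<^esub> r = 0" "r \<otimes>\<^bsub>monoid_algebra M\<^esub> 0 = 0"
  by (simp_all add: monoid_algebra_def)

lemma monoid_algebra_sum_mult:
  "sum f A \<otimes>\<^bsub>monoid_algebra M\<^esub> r = (\<Sum>x\<in>A. f x \<otimes>\<^bsub>monoid_algebra M\<^esub> r)"
  "r \<otimes>\<^bsub>monoid_algebra M\<^esub> sum f A = (\<Sum>x\<in>A. r \<otimes>\<^bsub>monoid_algebra M\<^esub> f x)"
  by (induction A rule: infinite_finite_induct) (simp_all add: monoid_algebra_distrib)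

lemma monoid_algebra_single_mult:
  "Poly_Mapping.single x c \<otimes>\<^bsub>monoid_algebra M\<^esub> q =
     (\<Sum>y\<in>Poly_Mapping.keys q. Poly_Mapping.single (x \<otimes>\<^bsub>M\<^esub> y) (c * Poly_Mapping.lookup q y))"
  by (subst monoid_algebra_mult[of "{x}" "Poly_Mapping.keys q"]) auto

lemma monoid_algebra_single_single:
  "Poly_Mapping.single x c \<otimes>\<^bsub>monoid_algebra M\<^esub> Poly_Mapping.single y d =
     Poly_Mapping.single (x \<otimes>\<^bsub>M\<^esub> y) (c * d)"
  by (subst monoid_algebra_mult[of "{x}" "{y}"]) auto

lemma poly_mapping_eq_sum_single:
  "p = (\<Sum>x\<in>Poly_Mapping.keys p. Poly_Mapping.single x (Poly_Mapping.lookup p x))"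
proof (rule poly_mapping_eqI)
  fix k
  show "Poly_Mapping.lookup p k = Poly_Mapping.lookup
    (\<Sum>x\<in>Poly_Mapping.keys p. Poly_Mapping.single x (Poly_Mapping.lookup p x)) k"
    by (cases "k \<in> Poly_Mapping.keys p")
      (auto simp: lookup_sum lookup_single when_def in_keys_iff cong: if_cong)
qed

lemma monoid_algebra_mult_closed:
  assumes "monoid M" "Poly_Mapping.keys p \<subseteq> carrier M" "Poly_Mapping.keys q \<subseteq> carrier M"
  shows "Poly_Mapping.keys (p \<otimes>\<^bsub>monoid_algebra M\<^esub> q) \<subseteq> carrier M"
proof -
  interpret monoid M by fact
  have "Poly_Mapping.keys (p \<otimes>\<^bsub>monoid_algebra M\<^esub> q) \<subseteq> 
    (\<Union>x\<in>Poly_Mapping.keys p. \<Union>y\<in>Poly_Mapping.keys q. {x \<otimes>\<^bsub>M\<^esub> y})"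
    unfolding monoid_algebra_def module.simps ring.simps monoid.simps
    by (intro order.trans[OF keys_sum] UN_mono) auto
  also have "\<dots> \<subseteq> carrier M" using assms by auto
  finally show ?thesis .
qed

lemma ring_monoid_algebra:
  fixes M :: "('m, 'x) monoid_scheme"
  assumes "monoid M"
  shows "ring (monoid_algebra M :: ('r::comm_ring_1, 'm \<Rightarrow>\<^sub>0 'r) module)"
proof (rule ringI)
  interpret monoid M by fact
  let ?A = "monoid_algebra M :: ('r, 'm \<Rightarrow>\<^sub>0 'r) module"
  note [simp] = monoid_algebra_simps
  show "abelian_group ?A"
  proof (rule abelian_groupI)
    fix x y assume "x \<in> carrier ?A" "y \<in> carrier ?A"
    then show "x \<oplus>\<^bsub>?A\<^esub> y \<in> carrier ?A" using Poly_Mapping.keys_add[of x y] by auto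
  next
    fix x assume "x \<in> carrier ?A"
    then show "\<exists>y\<in>carrier ?A. y \<oplus>\<^bsub>?A\<^esub> x = \<zero>\<^bsub>?A\<^esub>"
      by (intro bexI[of _ "- x"]) (auto simp: in_keys_iff)
  qed (simp_all add: add_ac)
  show "monoid ?A"
  proof (rule monoidI)
    fix p q r assume pqr: "p \<in> carrier ?A" "q \<in> carrier ?A" "r \<in> carrier ?A"
    show "p \<otimes>\<^bsub>?A\<^esub> q \<in> carrier ?A"
      using monoid_algebra_mult_closed[OF assms] pqr by simp
    have "p \<otimes>\<^bsub>?A\<^esub> q \<otimes>\<^bsub>?A\<^esub> r = (\<Sum>x\<in>Poly_Mapping.keys p. \<Sum>y\<in>Poly_Mapping.keys q. \<Sum>z\<in>Poly_Mapping.keys r.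
      Poly_Mapping.single (x \<otimes>\<^bsub>M\<^esub> y \<otimes>\<^bsub>M\<^esub> z) (Poly_Mapping.lookup p x * Poly_Mapping.lookup q y * Poly_Mapping.lookup r z))"
      by (subst monoid_algebra_mult[of "Poly_Mapping.keys p" "Poly_Mapping.keys q" p q])
        (simp_all add: monoid_algebra_sum_mult monoid_algebra_single_mult)
    also have "\<dots> = (\<Sum>x\<in>Poly_Mapping.keys p. \<Sum>y\<in>Poly_Mapping.keys q. \<Sum>z\<in>Poly_Mapping.keys r.
      Poly_Mapping.single (x \<otimes>\<^bsub>M\<^esub> (y \<otimes>\<^bsub>M\<^esub> z)) (Poly_Mapping.lookup p x * (Poly_Mapping.lookup q y * Poly_Mapping.lookup r z)))"
      using pqr by (intro sum.cong refl) (auto simp: m_assoc mult.assoc subset_iff)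
    also have "\<dots> = (\<Sum>x\<in>Poly_Mapping.keys p. Poly_Mapping.single x (Poly_Mapping.lookup p x) \<otimes>\<^bsub>?A\<^esub> (q \<otimes>\<^bsub>?A\<^esub> r))"
      by (subst monoid_algebra_mult[of "Poly_Mapping.keys q" "Poly_Mapping.keys r" q r])
        (simp_all add: monoid_algebra_sum_mult monoid_algebra_single_single)
    also have "\<dots> = p \<otimes>\<^bsub>?A\<^esub> (q \<otimes>\<^bsub>?A\<^esub> r)"
      by (simp flip: monoid_algebra_sum_mult(1) poly_mapping_eq_sum_single)
    finally show "p \<otimes>\<^bsub>?A\<^esub> q \<otimes>\<^bsub>?A\<^esub> r = p \<otimes>\<^bsub>?A\<^esub> (q \<otimes>\<^bsub>?A\<^esub> r)" .
  next
    fix p assume p: "p \<in> carrier ?A"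
    show "\<one>\<^bsub>?A\<^esub> \<otimes>\<^bsub>?A\<^esub> p = p"
      by (subst (2) poly_mapping_eq_sum_single[of p])
        (use p in \<open>auto simp: monoid_algebra_single_mult intro!: sum.cong\<close>)
    show "p \<otimes>\<^bsub>?A\<^esub> \<one>\<^bsub>?A\<^esub> = p"
      by (subst (2) poly_mapping_eq_sum_single[of p], subst monoid_algebra_mult[of "Poly_Mapping.keys p" "{\<one>\<^bsub>M\<^esub>}"])
        (use p in \<open>auto intro!: sum.cong\<close>)
  qed simp
qed (simp_all add: monoid_algebra_simps monoid_algebra_distrib)


section \<open>Linear extension of monoid representations\<close>

locale scalar_hom =
  fixes \<eta> :: "'r::comm_ring_1 \<Rightarrow> 'k::field"
  assumes hom_add: "\<eta> (a + b) = \<eta> a + \<eta> b"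
    and hom_mult: "\<eta> (a * b) = \<eta> a * \<eta> b"
    and hom_one: "\<eta> 1 = 1"
begin

lemma hom_zero: "\<eta> 0 = 0"
  using hom_add[of 0 0] by (metis add.right_neutral add_left_cancel)

end

text \<open>Instantiated twice: with the free monoid on the generators, scalars acting through
  \<open>\<rho>\<close>, and with the multiplicative monoid of pairs that underlies the tensor
  product, where the scalars are integers.\<close>

locale monoid_rep = monoid M + scalar_hom \<eta>
  for M :: "('m, 'x) monoid_scheme" (structure) and \<eta> :: "'r::comm_ring_1 \<Rightarrow> 'k::field" +
  fixes n :: nat and F :: "'m \<Rightarrow> ((int \<Rightarrow> int) \<Rightarrow>\<^sub>0 'k) \<Rightarrow> ((int \<Rightarrow> int) \<Rightarrow>\<^sub>0 'k)"
  assumes F_closed: "x \<in> carrier M \<Longrightarrow> F x \<in> carrier (End_space n)"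
    and F_mult: "x \<in> carrier M \<Longrightarrow> y \<in> carrier M \<Longrightarrow> F (x \<otimes> y) = F x \<otimes>\<^bsub>End_space n\<^esub> F y"
    and F_one: "F \<one> = \<one>\<^bsub>End_space n\<^esub>"
begin

definition ext :: "('m \<Rightarrow>\<^sub>0 'r) \<Rightarrow> ((int \<Rightarrow> int) \<Rightarrow>\<^sub>0 'k) \<Rightarrow> ((int \<Rightarrow> int) \<Rightarrow>\<^sub>0 'k)" where
  "ext p = (\<lambda>v\<in>tensor_space n. \<Sum>x\<in>Poly_Mapping.keys p. scale (\<eta> (Poly_Mapping.lookup p x)) (F x v))"

lemma ext_extensional: "ext p \<in> extensional (tensor_space n)"
  by (simp add: ext_def)

lemma ext_apply:
  assumes "finite A" "Poly_Mapping.keys p \<subseteq> A" "v \<in> tensor_space n"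
  shows "ext p v = (\<Sum>x\<in>A. scale (\<eta> (Poly_Mapping.lookup p x)) (F x v))"
  unfolding ext_def using assms
  by (simp, intro sum.mono_neutral_left) (auto simp: in_keys_iff hom_zero)

lemma ext_single: "v \<in> tensor_space n \<Longrightarrow> ext (Poly_Mapping.single x c) v = scale (\<eta> c) (F x v)"
  by (subst ext_apply[of "{x}"]) auto

lemma ext_add:
  assumes "v \<in> tensor_space n"
  shows "ext (p + q) v = ext p v + ext q v"
proof -
  let ?A = "Poly_Mapping.keys p \<union> Poly_Mapping.keys q"
  show ?thesis
    by (subst (1 2 3) ext_apply[of ?A])
      (use assms Poly_Mapping.keys_add[of p q] in \<open>auto simp: lookup_add hom_add scale_add sum.distrib\<close>)
qed

lemma ext_zero: "v \<in> tensor_space n \<Longrightarrow> ext 0 v = 0"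
  by (simp add: ext_def)

lemma ext_diff:
  assumes "v \<in> tensor_space n"
  shows "ext (p - q) v = ext p v - ext q v"
  using ext_add[OF assms, of "p - q" q] by simp

lemma ext_sum:
  assumes "v \<in> tensor_space n"
  shows "ext (sum f A) v = (\<Sum>x\<in>A. ext (f x) v)"
  by (induction A rule: infinite_finite_induct) (simp_all add: assms ext_zero ext_add)

lemma ext_closed:
  assumes "Poly_Mapping.keys p \<subseteq> carrier M"
  shows "ext p \<in> carrier (End_space n)"
proof -
  have F: "F x \<in> carrier (End_space n)" if "x \<in> Poly_Mapping.keys p" for x
    using that assms F_closed by auto
  have "ext p v \<in> tensor_space n" if "v \<in> tensor_space n" for v
    using that F by (auto simp: ext_def End_space_iff intro!: tensor_space_sum tensor_space_closed)
  moreover have "ext p (u + v) = ext p u + ext p v" if "u \<in> tensor_space n" "v \<in> tensor_space n" for u v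
    using that F
    by (simp add: ext_def tensor_space_closed sum.distrib[symmetric] End_space_iff scale_add cong: sum.cong)
  moreover have "ext p (scale c v) = scale c (ext p v)" if "v \<in> tensor_space n" for c v
    using that F
    by (simp add: ext_def tensor_space_closed scale_sum End_space_iff mult.commute cong: sum.cong)
  ultimately show ?thesis
    by (simp add: End_space_iff) (simp add: ext_def)
qed

lemma ext_mult:
  assumes p: "Poly_Mapping.keys p \<subseteq> carrier M" and q: "Poly_Mapping.keys q \<subseteq> carrier M"
  shows "ext (p \<otimes>\<^bsub>monoid_algebra M\<^esub> q) = ext p \<otimes>\<^bsub>End_space n\<^esub> ext q"
proof (rule End_space_eqI)
  show "ext (p \<otimes>\<^bsub>monoid_algebra M\<^esub> q) \<in> carrier (End_space n)"
    by (intro ext_closed monoid_algebra_mult_closed monoid_axioms p q)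
  show "ext p \<otimes>\<^bsub>End_space n\<^esub> ext q \<in> carrier (End_space n)"
    by (intro End_space_closed ext_closed p q)
  fix v :: "(int \<Rightarrow> int) \<Rightarrow>\<^sub>0 'k" assume v: "v \<in> tensor_space n"
  have F: "F x u \<in> tensor_space n" "F x (scale c u) = scale c (F x u)"
    if "x \<in> carrier M" "u \<in> tensor_space n" for x u c
    using F_closed[OF that(1)] that(2) by (auto simp: End_space_iff)
  let ?P = "Poly_Mapping.keys p" and ?Q = "Poly_Mapping.keys q"
  have FF: "F (x \<otimes> y) v = F x (F y v)" if "x \<in> ?P" "y \<in> ?Q" for x y
    using that p q v by (subst F_mult) (auto simp: End_space_simps compose_def)
  have "ext (p \<otimes>\<^bsub>monoid_algebra M\<^esub> q) v = (\<Sum>x\<in>?P. \<Sum>y\<in>?Q.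
      scale (\<eta> (Poly_Mapping.lookup p x)) (scale (\<eta> (Poly_Mapping.lookup q y)) (F x (F y v))))"
    by (subst monoid_algebra_mult[of ?P ?Q]) (simp_all add: ext_sum ext_single v hom_mult FF)
  also have "\<dots> = (\<Sum>x\<in>?P. scale (\<eta> (Poly_Mapping.lookup p x)) (F x (ext q v)))"
  proof (rule sum.cong[OF refl])
    fix x assume "x \<in> ?P"
    then have x: "x \<in> carrier M" using p by auto
    have "F x (ext q v) = (\<Sum>y\<in>?Q. F x (scale (\<eta> (Poly_Mapping.lookup q y)) (F y v)))"
      unfolding ext_def restrict_def using v
      by simp (rule End_space_sum[OF F_closed[OF x]], use q F v in \<open>auto intro!: tensor_space_closed\<close>)
    also have "\<dots> = (\<Sum>y\<in>?Q. scale (\<eta> (Poly_Mapping.lookup q y)) (F x (F y v)))"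
      by (intro sum.cong refl F(2) x F(1) v) (use q in auto)
    finally show "(\<Sum>y\<in>?Q. scale (\<eta> (Poly_Mapping.lookup p x))
        (scale (\<eta> (Poly_Mapping.lookup q y)) (F x (F y v)))) =
      scale (\<eta> (Poly_Mapping.lookup p x)) (F x (ext q v))"
      by (simp only: scale_sum)
  qed
  also have "\<dots> = ext p (ext q v)"
    using ext_closed[OF q] v by (simp add: ext_def[of p] End_space_iff)
  finally show "ext (p \<otimes>\<^bsub>monoid_algebra M\<^esub> q) v = (ext p \<otimes>\<^bsub>End_space n\<^esub> ext q) v"
    using v by (simp add: End_space_simps compose_def)
qed

lemma ext_hom: "ext \<in> ring_hom (monoid_algebra M) (End_space n)"
proof (rule ring_hom_memI)
  have "ext (Poly_Mapping.single \<one> 1) = \<one>\<^bsub>End_space n\<^esub>"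
    by (rule End_space_eqI[OF ext_closed End_space_const_closed(1)])
      (use F_one in \<open>auto simp: ext_single hom_one\<close>)
  then show "ext \<one>\<^bsub>monoid_algebra M\<^esub> = \<one>\<^bsub>End_space n\<^esub>"
    by (simp add: monoid_algebra_simps)
  fix p q :: "'m \<Rightarrow>\<^sub>0 'r"
  assume "p \<in> carrier (monoid_algebra M)" "q \<in> carrier (monoid_algebra M)"
  then have pq: "Poly_Mapping.keys p \<subseteq> carrier M" "Poly_Mapping.keys q \<subseteq> carrier M"
    by (auto simp: monoid_algebra_simps)
  show "ext (p \<oplus>\<^bsub>monoid_algebra M\<^esub> q) = ext p \<oplus>\<^bsub>End_space n\<^esub> ext q"
    by (rule extensionalityI[of _ "tensor_space n"])
      (auto simp: monoid_algebra_simps End_space_simps ext_extensional ext_add)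
qed (auto simp: ext_closed ext_mult monoid_algebra_simps)

end

section \<open>Descent to quotient algebras\<close>

lemma FactRing_carrierD:
  "X \<in> carrier (R Quot I) \<Longrightarrow> \<exists>x\<in>carrier R. X = I +>\<^bsub>R\<^esub> x"
  by (auto simp: FactRing_def A_RCOSETS_def')

lemma ring_hom_quotient:
  assumes "ring R" "ring S" "h \<in> ring_hom R S" "ideal I R" "\<And>i. i \<in> I \<Longrightarrow> h i = \<zero>\<^bsub>S\<^esub>"
  obtains \<phi> where "\<phi> \<in> ring_hom (R Quot I) S" "\<And>x. x \<in> carrier R \<Longrightarrow> \<phi> (I +>\<^bsub>R\<^esub> x) = h x"
proof -
  interpret R: ring R by fact
  interpret S: ring S by fact
  interpret I: ideal I R by fact
  interpret h: ring_hom_ring R S h using assms by (intro ring_hom_ringI2)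
  \<comment> \<open>Any choice of representative gives the same value: two of them differ by an
    element of \<open>I\<close>, on which \<open>h\<close> vanishes.\<close>
  define \<phi> where "\<phi> X = h (SOME x. x \<in> X)" for X
  have \<phi>: "\<phi> (I +>\<^bsub>R\<^esub> x) = h x" if x: "x \<in> carrier R" for x
  proof -
    have "(SOME y. y \<in> I +>\<^bsub>R\<^esub> x) \<in> I +>\<^bsub>R\<^esub> x"
      using I.a_rcos_self[OF x] by (rule someI)
    then obtain i where "i \<in> I" "(SOME y. y \<in> I +>\<^bsub>R\<^esub> x) = i \<oplus>\<^bsub>R\<^esub> x"
      by (auto simp: a_r_coset_def')
    then show ?thesis using x assms(5) I.Icarr by (simp add: \<phi>_def)
  qed
  interpret c: ring_hom_ring R "R Quot I" "(+>\<^bsub>R\<^esub>) I" by (rule I.rcos_ring_hom_ring)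
  have "\<phi> \<in> ring_hom (R Quot I) S"
  proof (rule ring_hom_memI)
    fix X assume "X \<in> carrier (R Quot I)"
    then show "\<phi> X \<in> carrier S" using FactRing_carrierD \<phi> h.hom_closed by metis
  next
    fix X Y assume "X \<in> carrier (R Quot I)" "Y \<in> carrier (R Quot I)"
    then obtain x y where "x \<in> carrier R" "y \<in> carrier R" "X = I +>\<^bsub>R\<^esub> x" "Y = I +>\<^bsub>R\<^esub> y"
      using FactRing_carrierD by metis
    then show "\<phi> (X \<otimes>\<^bsub>R Quot I\<^esub> Y) = \<phi> X \<otimes>\<^bsub>S\<^esub> \<phi> Y" "\<phi> (X \<oplus>\<^bsub>R Quot I\<^esub> Y) = \<phi> X \<oplus>\<^bsub>S\<^esub> \<phi> Y"
      using \<phi> by (simp_all flip: c.hom_mult c.hom_add)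
  next
    show "\<phi> \<one>\<^bsub>R Quot I\<^esub> = \<one>\<^bsub>S\<^esub>"
      using \<phi>[OF R.one_closed] by (simp flip: c.hom_one)
  qed
  with \<phi> that show thesis by blast
qed

text \<open>The kernel of \<open>h\<close> is a two-sided ideal, so with \<open>A\<close> it
  contains the ideal generated by \<open>A\<close>.\<close>

lemma genideal_hom_zero:
  assumes "ring R" "ring S" "h \<in> ring_hom R S" "A \<subseteq> carrier R" "\<And>a. a \<in> A \<Longrightarrow> h a = \<zero>\<^bsub>S\<^esub>"
    "i \<in> Idl\<^bsub>R\<^esub> A"
  shows "h i = \<zero>\<^bsub>S\<^esub>"
proof -
  interpret h: ring_hom_ring R S h using assms(1-3) by (rule ring_hom_ringI2)
  have "Idl\<^bsub>R\<^esub> A \<subseteq> {x \<in> carrier R. h x = \<zero>\<^bsub>S\<^esub>}"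
    using h.R.genideal_minimal[OF h.kernel_is_ideal, of A] assms(4,5) unfolding a_kernel_def' by blast
  with assms(6) show ?thesis by blast
qed

lemma ring_extend_simps [simp]:
  "carrier (ring.extend R m) = carrier R" "mult (ring.extend R m) = mult R"
  "one (ring.extend R m) = one R" "zero (ring.extend R m) = zero R" "add (ring.extend R m) = add R"
  by (simp_all add: ring.defs)

lemma ring_hom_extend: "ring_hom (ring.extend R m) S = ring_hom R S"
  by (simp add: ring_hom_def)

lemma ring_extend:
  assumes "ring R"
  shows "ring (ring.extend R m)"
proof -
  interpret ring R by fact
  show ?thesis
  proof (rule ringI)
    show "abelian_group (ring.extend R m)"
      by (rule abelian_groupI) (auto simp: a_assoc intro: a_comm bexI[of _ "\<ominus>\<^bsub>R\<^esub> x" for x] l_neg)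
    show "monoid (ring.extend R m)"
      by (rule monoidI) (auto simp: m_assoc)
  qed (auto simp: l_distr r_distr)
qed

text \<open>Turns the scalar action into a multiplication, which ring homomorphisms and passage to
  cosets respect.\<close>

lemma (in monoid) monoid_algebra_scale:
  assumes "p \<in> carrier (monoid_algebra G)"
  shows "Poly_Mapping.single \<one> c \<otimes>\<^bsub>monoid_algebra G\<^esub> p = scale c p"
proof -
  have "Poly_Mapping.single \<one> c \<otimes>\<^bsub>monoid_algebra G\<^esub> p =
    scale c (\<Sum>x\<in>Poly_Mapping.keys p. Poly_Mapping.single x (Poly_Mapping.lookup p x))"
    unfolding monoid_algebra_single_mult scale_sum
    using assms by (intro sum.cong) (auto simp: monoid_algebra_simps)
  then show ?thesis by (simp flip: poly_mapping_eq_sum_single)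
qed

lemma quot_algebra_simps [simp]:
  "carrier (quot_algebra A S) = carrier (A Quot Idl\<^bsub>A\<^esub> S)"
  "mult (quot_algebra A S) = mult (A Quot Idl\<^bsub>A\<^esub> S)"
  "one (quot_algebra A S) = one (A Quot Idl\<^bsub>A\<^esub> S)"
  "ring_hom (quot_algebra A S) B = ring_hom (A Quot Idl\<^bsub>A\<^esub> S) B"
  "c \<odot>\<^bsub>quot_algebra A S\<^esub> X = (\<Union>x\<in>X. Idl\<^bsub>A\<^esub> S +>\<^bsub>A\<^esub> (c \<odot>\<^bsub>A\<^esub> x))"
  by (simp_all add: quot_algebra_def Let_def ring_hom_extend) (simp add: ring.defs module.defs)

lemma ring_quot_algebra:
  assumes "ring A" "S \<subseteq> carrier A"
  shows "ring (quot_algebra A S)"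
  unfolding quot_algebra_def Let_def
  by (intro ring_extend ideal.quotient_is_ring ring.genideal_ideal assms)

context monoid_rep
begin

lemma ext_eq_zeroI:
  assumes "\<And>v. v \<in> tensor_space n \<Longrightarrow> ext p v = 0"
  shows "ext p = \<zero>\<^bsub>End_space n\<^esub>"
  unfolding End_space_simps
  by (rule extensionalityI[OF ext_extensional restrict_extensional]) (simp add: assms)

text \<open>Besides the homomorphism, the two facts about scalars are produced because the extension
  of scalars takes them as hypotheses.\<close>

lemma quot_algebra_rep:
  assumes S: "S \<subseteq> carrier (monoid_algebra M)" and zero: "\<And>p. p \<in> S \<Longrightarrow> ext p = \<zero>\<^bsub>End_space n\<^esub>"
  defines "A \<equiv> monoid_algebra M :: ('r, 'm \<Rightarrow>\<^sub>0 'r) module"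
  obtains \<phi> where "\<phi> \<in> ring_hom (quot_algebra A S) (End_space n)"
    "\<And>p. p \<in> carrier A \<Longrightarrow> \<phi> (Idl\<^bsub>A\<^esub> S +>\<^bsub>A\<^esub> p) = ext p"
    "\<And>c X. X \<in> carrier (quot_algebra A S) \<Longrightarrow> c \<odot>\<^bsub>quot_algebra A S\<^esub> X \<in> carrier (quot_algebra A S)"
    "\<And>c X. X \<in> carrier (quot_algebra A S) \<Longrightarrow> \<phi> (c \<odot>\<^bsub>quot_algebra A S\<^esub> X) = \<eta> c \<odot>\<^bsub>End_space n\<^esub> \<phi> X"
proof -
  have rA: "ring A" unfolding A_def by (rule ring_monoid_algebra) unfold_locales
  interpret A: ring A by fact
  define I where "I = Idl\<^bsub>A\<^esub> S"
  interpret I: ideal I A unfolding I_def using S by (intro A.genideal_ideal) (simp add: A_def)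
  interpret c: ring_hom_ring A "A Quot I" "(+>\<^bsub>A\<^esub>) I" by (rule I.rcos_ring_hom_ring)
  have zeroI: "ext i = \<zero>\<^bsub>End_space n\<^esub>" if "i \<in> I" for i
    using rA ring_End_space ext_hom[folded A_def] S[folded A_def] zero that[unfolded I_def]
    by (rule genideal_hom_zero)
  obtain \<phi> where \<phi>: "\<phi> \<in> ring_hom (A Quot I) (End_space n)"
      "\<And>p. p \<in> carrier A \<Longrightarrow> \<phi> (I +>\<^bsub>A\<^esub> p) = ext p"
    by (rule ring_hom_quotient[OF rA ring_End_space ext_hom[folded A_def] I.ideal_axioms zeroI], assumption, rule that)
  have sc: "Poly_Mapping.single \<one> c \<in> carrier A" for c
    using one_closed by (auto simp: A_def monoid_algebra_simps)
  \<comment> \<open>The scalar action on a coset is defined as a union over its representatives.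
    Each of them yields the same coset, so the union collapses to a product of cosets.\<close>
  have smult: "c \<odot>\<^bsub>quot_algebra A S\<^esub> X = (I +>\<^bsub>A\<^esub> Poly_Mapping.single \<one> c) \<otimes>\<^bsub>A Quot I\<^esub> X"
    if X: "X \<in> carrier (A Quot I)" for c X
  proof -
    obtain y where y: "y \<in> carrier A" "X = I +>\<^bsub>A\<^esub> y"
      using FactRing_carrierD[OF X] by blast
    have *: "I +>\<^bsub>A\<^esub> (c \<odot>\<^bsub>A\<^esub> x) = (I +>\<^bsub>A\<^esub> Poly_Mapping.single \<one> c) \<otimes>\<^bsub>A Quot I\<^esub> X"
      if xX: "x \<in> X" for x
    proof -
      have x: "x \<in> carrier A"
        using xX A.a_r_coset_subset_G[OF I.a_subset y(1)] y(2) by blast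
      have X: "X = I +>\<^bsub>A\<^esub> x"
        unfolding y(2) using xX[unfolded y(2)] y(1) I.a_subgroup by (rule A.a_repr_independence)
      have "c \<odot>\<^bsub>A\<^esub> x = Poly_Mapping.single \<one> c \<otimes>\<^bsub>A\<^esub> x"
        using monoid_algebra_scale[OF x[unfolded A_def]] by (simp add: A_def monoid_algebra_simps)
      then show ?thesis using c.hom_mult[OF sc x] X by simp
    qed
    have "X \<noteq> {}" using I.a_rcos_self[OF y(1)] y(2) by blast
    then show ?thesis unfolding quot_algebra_simps I_def[symmetric]
      by (subst SUP_cong[OF refl *]) simp_all
  qed
  have car: "carrier (quot_algebra A S) = carrier (A Quot I)" by (simp add: I_def)
  show thesis
  proof (rule that)
    show "\<phi> \<in> ring_hom (quot_algebra A S) (End_space n)" using \<phi> by (simp flip: I_def)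
    show "\<phi> (Idl\<^bsub>A\<^esub> S +>\<^bsub>A\<^esub> p) = ext p" if "p \<in> carrier A" for p using \<phi> that by (simp flip: I_def)
  next
    fix c X assume "X \<in> carrier (quot_algebra A S)"
    then have X: "X \<in> carrier (A Quot I)" by (simp only: car)
    then show "c \<odot>\<^bsub>quot_algebra A S\<^esub> X \<in> carrier (quot_algebra A S)"
      unfolding car smult[OF X] using sc by simp
    have cl: "\<phi> X \<in> carrier (End_space n)" using X \<phi>(1) by (auto simp: ring_hom_def)
    have "\<phi> (c \<odot>\<^bsub>quot_algebra A S\<^esub> X) = ext (Poly_Mapping.single \<one> c) \<otimes>\<^bsub>End_space n\<^esub> \<phi> X"
      unfolding smult[OF X] using ring_hom_mult[OF \<phi>(1) _ X] sc \<phi>(2) by simp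
    also have "\<dots> = \<eta> c \<odot>\<^bsub>End_space n\<^esub> \<phi> X"
      using cl
      by (auto simp: fun_eq_iff End_space_simps compose_def End_space_iff ext_single F_one)
    finally show "\<phi> (c \<odot>\<^bsub>quot_algebra A S\<^esub> X) = \<eta> c \<odot>\<^bsub>End_space n\<^esub> \<phi> X" .
  qed
qed

end

section \<open>Extension of scalars\<close>

lemma scalar_extension_simps [simp]:
  "carrier (scalar_extension h B) = carrier (tensor_free B Quot tensor_ideal h B)"
  "ring_hom (scalar_extension h B) S = ring_hom (tensor_free B Quot tensor_ideal h B) S"
  "c \<odot>\<^bsub>scalar_extension h B\<^esub> X = tensor_elem h B c \<one>\<^bsub>B\<^esub> \<otimes>\<^bsub>tensor_free B Quot tensor_ideal h B\<^esub> X"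
  by (simp_all add: scalar_extension_def Let_def ring_hom_extend) (simp add: ring.defs module.defs)

lemma DirProd_mult_monoid:
  assumes "monoid B"
  shows "monoid (mult_monoid \<times>\<times> B)"
proof -
  have "monoid mult_monoid" by (rule monoidI) (auto simp: mult_monoid_def mult.assoc)
  then show ?thesis using assms by (rule DirProd_monoid)
qed

text \<open>The map sending \<open>(s, b)\<close> to \<open>s\<close> times \<open>\<phi> b\<close>
  is multiplicative because scalars commute with linear operators. Its additive extension kills the
  bilinearity relators by linearity and the balancing relators by \<open>smult\<close>, hence it
  descends to the tensor product.\<close>

lemma scalar_extension_rep:
  fixes B :: "('z, 'b) module" and h :: "'z \<Rightarrow> 'k::field"
  assumes B: "ring B" and \<phi>: "\<phi> \<in> ring_hom B (End_space n)"
    and smult_closed: "\<And>c b. b \<in> carrier B \<Longrightarrow> c \<odot>\<^bsub>B\<^esub> b \<in> carrier B"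
    and smult: "\<And>c b. b \<in> carrier B \<Longrightarrow> \<phi> (c \<odot>\<^bsub>B\<^esub> b) = h c \<odot>\<^bsub>End_space n\<^esub> \<phi> b"
  obtains \<psi> where "\<psi> \<in> algebra_hom (scalar_extension h B) (End_space n)"
    "\<And>s b. b \<in> carrier B \<Longrightarrow> \<psi> (tensor_elem h B s b) = s \<odot>\<^bsub>End_space n\<^esub> \<phi> b"
proof -
  interpret B: ring B by fact
  define F where "F = (\<lambda>(s, b). s \<odot>\<^bsub>End_space n\<^esub> \<phi> b)"
  have \<phi>c: "\<phi> b \<in> carrier (End_space n)" if "b \<in> carrier B" for b
    using ring_hom_closed[OF \<phi> that] .
  have Fv: "F (s, b) v = scale s (\<phi> b v)" if "v \<in> tensor_space n" for s b v
    using that by (simp add: F_def End_space_simps)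
  interpret T: monoid_rep "mult_monoid \<times>\<times> B" "of_int :: int \<Rightarrow> 'k" n F
  proof (intro monoid_rep.intro monoid_rep_axioms.intro scalar_hom.intro DirProd_mult_monoid B.monoid_axioms)
    fix x :: "'k \<times> 'b" assume "x \<in> carrier (mult_monoid \<times>\<times> B)"
    then show "F x \<in> carrier (End_space n)"
      by (auto simp: F_def DirProd_def intro!: End_space_closed \<phi>c)
  next
    fix x y :: "'k \<times> 'b" assume "x \<in> carrier (mult_monoid \<times>\<times> B)" "y \<in> carrier (mult_monoid \<times>\<times> B)"
    then show "F (x \<otimes>\<^bsub>mult_monoid \<times>\<times> B\<^esub> y) = F x \<otimes>\<^bsub>End_space n\<^esub> F y"
      using \<phi>c by (auto simp: F_def DirProd_def mult_monoid_def ring_hom_mult[OF \<phi>] End_space_simps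
        End_space_iff compose_def fun_eq_iff tensor_space_closed)
  next
    show "F \<one>\<^bsub>mult_monoid \<times>\<times> B\<^esub> = \<one>\<^bsub>End_space n\<^esub>"
      by (auto simp: F_def DirProd_def mult_monoid_def ring_hom_one[OF \<phi>] End_space_simps fun_eq_iff)
  qed auto
  let ?T = "tensor_free B :: (int, ('k \<times> 'b) \<Rightarrow>\<^sub>0 int) module"
  have T: "?T = monoid_algebra (mult_monoid \<times>\<times> B)" by (simp add: tensor_free_def)
  have rT: "ring ?T" unfolding T by (rule ring_monoid_algebra) unfold_locales
  interpret TR: ring ?T by fact
  note hom = T.ext_hom[folded T]
  have single: "Poly_Mapping.single (s, b) c \<in> carrier ?T" if "b \<in> carrier B" for s b c
    using that by (auto simp: T monoid_algebra_simps DirProd_def mult_monoid_def)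
  have minus: "p - q \<in> carrier ?T" if "p \<in> carrier ?T" "q \<in> carrier ?T" for p q
    using that keys_diff[of p q] by (auto simp: T monoid_algebra_simps)
  have S: "tensor_relators h B \<subseteq> carrier ?T"
  proof
    fix p :: "('k \<times> 'b) \<Rightarrow>\<^sub>0 int" assume "p \<in> tensor_relators h B"
    then show "p \<in> carrier ?T"
      by induction (auto intro!: minus single smult_closed)
  qed
  have zero: "T.ext p = \<zero>\<^bsub>End_space n\<^esub>" if "p \<in> tensor_relators h B" for p
    using that
  proof induction
    case (add_left b s s')
    then show ?case
      by (intro T.ext_eq_zeroI) (simp add: T.ext_diff T.ext_single Fv scale_add)
  next
    case (add_right b b' s)
    then show ?case
      by (intro T.ext_eq_zeroI) (simp add: T.ext_diff T.ext_single Fv scale_add ring_hom_add[OF \<phi>] End_space_simps)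
  next
    case (balanced b s r)
    then show ?case
      by (intro T.ext_eq_zeroI) (simp add: T.ext_diff T.ext_single Fv smult End_space_simps mult.commute)
  qed
  define I where "I = tensor_ideal h B"
  interpret I: ideal I ?T unfolding I_def tensor_ideal_def by (rule TR.genideal_ideal[OF S])
  interpret c: ring_hom_ring ?T "?T Quot I" "(+>\<^bsub>?T\<^esub>) I" by (rule I.rcos_ring_hom_ring)
  have zeroI: "T.ext i = \<zero>\<^bsub>End_space n\<^esub>" if "i \<in> I" for i
    using rT ring_End_space hom S zero that[unfolded I_def tensor_ideal_def]
    by (rule genideal_hom_zero)
  obtain \<psi> where \<psi>: "\<psi> \<in> ring_hom (?T Quot I) (End_space n)"
      "\<And>p. p \<in> carrier ?T \<Longrightarrow> \<psi> (I +>\<^bsub>?T\<^esub> p) = T.ext p"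
    by (rule ring_hom_quotient[OF rT ring_End_space hom I.ideal_axioms zeroI], assumption, rule that)
  have elem: "\<psi> (tensor_elem h B s b) = s \<odot>\<^bsub>End_space n\<^esub> \<phi> b" if "b \<in> carrier B" for s b
  proof -
    have "\<psi> (tensor_elem h B s b) = T.ext (Poly_Mapping.single (s, b) 1)"
      using \<psi>(2) single that by (simp add: tensor_elem_def I_def)
    also have "\<dots> = s \<odot>\<^bsub>End_space n\<^esub> \<phi> b"
      unfolding End_space_simps
      by (rule extensionalityI[OF T.ext_extensional restrict_extensional]) (simp add: T.ext_single Fv)
    finally show ?thesis .
  qed
  \<comment> \<open>A scalar acts as multiplication by its tensor product with the unit, so
    compatibility with scalars is a case of multiplicativity.\<close>
  have "\<psi> (c \<odot>\<^bsub>scalar_extension h B\<^esub> X) = c \<odot>\<^bsub>End_space n\<^esub> \<psi> X" if X: "X \<in> carrier (?T Quot I)" for c X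
  proof -
    have cl: "\<psi> X \<in> carrier (End_space n)" using ring_hom_closed[OF \<psi>(1) X] .
    have "tensor_elem h B c \<one>\<^bsub>B\<^esub> \<in> carrier (?T Quot I)"
      unfolding tensor_elem_def I_def[symmetric] using single by simp
    then have "\<psi> (c \<odot>\<^bsub>scalar_extension h B\<^esub> X) = (c \<odot>\<^bsub>End_space n\<^esub> \<one>\<^bsub>End_space n\<^esub>) \<otimes>\<^bsub>End_space n\<^esub> \<psi> X"
      using ring_hom_mult[OF \<psi>(1) _ X] by (simp add: elem ring_hom_one[OF \<phi>] flip: I_def)
    also have "\<dots> = c \<odot>\<^bsub>End_space n\<^esub> \<psi> X"
      using cl by (auto simp: fun_eq_iff End_space_simps compose_def End_space_iff)
    finally show ?thesis .
  qed
  then have "\<psi> \<in> algebra_hom (scalar_extension h B) (End_space n)"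
    using \<psi>(1) by (simp add: algebra_hom_def flip: I_def)
  with elem that show thesis by blast
qed

section \<open>Evaluation homomorphisms\<close>

text \<open>With \<open>\<chi>\<close> a product of powers of the values this is
  \<open>param_eval\<close> or \<open>weight_eval\<close>, so natural and integer exponents share
  one argument.\<close>

definition monomial_eval :: "('m \<Rightarrow> 'k) \<Rightarrow> ('m \<Rightarrow>\<^sub>0 int) \<Rightarrow> 'k::comm_ring_1" where
  "monomial_eval \<chi> p = (\<Sum>m\<in>Poly_Mapping.keys p. of_int (Poly_Mapping.lookup p m) * \<chi> m)"

lemma monomial_eval_superset:
  assumes "finite A" "Poly_Mapping.keys p \<subseteq> A"
  shows "monomial_eval \<chi> p = (\<Sum>m\<in>A. of_int (Poly_Mapping.lookup p m) * \<chi> m)"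
  unfolding monomial_eval_def
  by (rule sum.mono_neutral_left) (use assms in \<open>auto simp: in_keys_iff\<close>)

lemma monomial_eval_single [simp]: "monomial_eval \<chi> (Poly_Mapping.single m c) = of_int c * \<chi> m"
  by (subst monomial_eval_superset[of "{m}"]) auto

lemma monomial_eval_add: "monomial_eval \<chi> (p + q) = monomial_eval \<chi> p + monomial_eval \<chi> q"
proof -
  let ?A = "Poly_Mapping.keys p \<union> Poly_Mapping.keys q"
  show ?thesis
    by (subst (1 2 3) monomial_eval_superset[of ?A])
      (use Poly_Mapping.keys_add[of p q] in \<open>auto simp: lookup_add algebra_simps sum.distrib\<close>)
qed

lemma monomial_eval_sum: "monomial_eval \<chi> (sum f A) = (\<Sum>x\<in>A. monomial_eval \<chi> (f x))"
  by (induction A rule: infinite_finite_induct)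
    (simp_all add: monomial_eval_add, simp_all add: monomial_eval_def)

lemma monomial_eval_mult:
  fixes p q :: "'m::monoid_add \<Rightarrow>\<^sub>0 int"
  assumes "\<And>m m'. \<chi> (m + m') = \<chi> m * \<chi> m'"
  shows "monomial_eval \<chi> (p * q) = monomial_eval \<chi> p * monomial_eval \<chi> q"
proof -
  have "p * q = (\<Sum>x\<in>Poly_Mapping.keys p. Poly_Mapping.single x (Poly_Mapping.lookup p x)) *
      (\<Sum>y\<in>Poly_Mapping.keys q. Poly_Mapping.single y (Poly_Mapping.lookup q y))"
    by (simp flip: poly_mapping_eq_sum_single)
  also have "\<dots> = (\<Sum>x\<in>Poly_Mapping.keys p. \<Sum>y\<in>Poly_Mapping.keys q.
      Poly_Mapping.single (x + y) (Poly_Mapping.lookup p x * Poly_Mapping.lookup q y))"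
    by (simp add: sum_product mult_single)
  finally show ?thesis
    by (simp add: monomial_eval_sum assms)
      (simp add: monomial_eval_def sum_product mult_ac)
qed

lemma prod_keys_add:
  fixes pw :: "'v \<Rightarrow> 'e::monoid_add \<Rightarrow> 'k::comm_monoid_mult"
  assumes "\<And>v. pw v 0 = 1" "\<And>v a b. pw v (a + b) = pw v a * pw v b"
  shows "(\<Prod>v\<in>Poly_Mapping.keys (m + m'). pw v (Poly_Mapping.lookup (m + m') v)) =
    (\<Prod>v\<in>Poly_Mapping.keys m. pw v (Poly_Mapping.lookup m v)) *
    (\<Prod>v\<in>Poly_Mapping.keys m'. pw v (Poly_Mapping.lookup m' v))"
proof -
  let ?A = "Poly_Mapping.keys m \<union> Poly_Mapping.keys m'"
  have *: "(\<Prod>v\<in>Poly_Mapping.keys u. pw v (Poly_Mapping.lookup u v)) = (\<Prod>v\<in>?A. pw v (Poly_Mapping.lookup u v))"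
    if "Poly_Mapping.keys u \<subseteq> ?A" for u
    by (rule prod.mono_neutral_left) (use that assms(1) in \<open>auto simp: in_keys_iff\<close>)
  show ?thesis
    by (subst (1 2 3) *) (use Poly_Mapping.keys_add[of m m'] in \<open>auto simp: lookup_add assms(2) prod.distrib\<close>)
qed

lemma param_eval_add: "param_eval s (p + q) = param_eval s p + param_eval s q"
  using monomial_eval_add by (simp add: param_eval_def monomial_eval_def)

lemma param_eval_mult: "param_eval s (p * q) = param_eval s p * param_eval s q"
  using monomial_eval_mult[of "\<lambda>m. \<Prod>v\<in>Poly_Mapping.keys m. s v ^ Poly_Mapping.lookup m v" p q]
    prod_keys_add[of "\<lambda>v e. s v ^ e"]
  by (simp add: param_eval_def monomial_eval_def power_add)

lemma param_eval_1: "param_eval s 1 = 1"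
  by (simp add: param_eval_def)

lemma param_eval_var: "param_eval s (param_var v) = s v"
  by (simp add: param_eval_def param_var_def)

lemma scalar_hom_param_eval: "scalar_hom (param_eval s)"
  by unfold_locales (simp_all add: param_eval_add param_eval_mult param_eval_1)

lemma weight_eval_add: "weight_eval s (p + q) = weight_eval s p + weight_eval s q"
  using monomial_eval_add by (simp add: weight_eval_def monomial_eval_def)

text \<open>At a zero value, integer powers would not turn sums of exponents into products: the
  powers with exponents 1 and -1 would multiply to 0.\<close>

lemma weight_eval_mult:
  assumes "\<And>v. s v \<noteq> 0"
  shows "weight_eval s (p * q) = weight_eval s p * weight_eval s q"
  using monomial_eval_mult[of "\<lambda>m. \<Prod>v\<in>Poly_Mapping.keys m. s v powi Poly_Mapping.lookup m v" p q]
    prod_keys_add[of "\<lambda>v e. s v powi e"] assms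
  by (simp add: weight_eval_def monomial_eval_def power_int_add)

lemma weight_eval_simps:
  "weight_eval s 0 = 0" "weight_eval s 1 = 1" "weight_eval s 2 = 2"
  "weight_eval s (weight_var v) = s v" "weight_eval s (weight_inv v) = 1 / s v"
proof -
  show *: "weight_eval s 1 = 1" by (simp add: weight_eval_def)
  show "weight_eval s 2 = 2" using weight_eval_add[of s 1 1] * by simp
qed (simp_all add: weight_eval_def weight_var_def weight_inv_def power_int_minus divide_inverse)

lemma weight_eval_uminus: "weight_eval s (- p) = - weight_eval s p"
  by (simp add: weight_eval_def sum_negf)

lemma weight_eval_of_int: "weight_eval s (of_int c) = of_int c"
proof -
  have nat: "weight_eval s (of_nat k) = of_nat k" for k
    by (induction k) (simp_all add: weight_eval_simps weight_eval_add)
  show ?thesis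
    by (cases c) (simp_all add: nat weight_eval_uminus weight_eval_add weight_eval_simps del: of_nat_Suc)
qed

lemma weight_eval_sum: "weight_eval s (sum f A) = (\<Sum>x\<in>A. weight_eval s (f x))"
  by (induction A rule: infinite_finite_induct) (simp_all add: weight_eval_add weight_eval_simps)

lemma weight_eval_prod:
  assumes "\<And>v. s v \<noteq> 0"
  shows "weight_eval s (prod f A) = (\<Prod>x\<in>A. weight_eval s (f x))"
  by (induction A rule: infinite_finite_induct) (simp_all add: weight_eval_mult[OF assms] weight_eval_simps)

lemma weight_eval_power:
  assumes "\<And>v. s v \<noteq> 0"
  shows "weight_eval s (p ^ k) = weight_eval s p ^ k"
  by (induction k) (simp_all add: weight_eval_mult[OF assms] weight_eval_simps)

text \<open>Composing with a ring homomorphism only changes the values at the variables. The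
  factorisation of \<open>\<rho>\<close> thereby becomes six equations for the weights.\<close>

lemma weight_eval_param_eval:
  assumes "\<And>v. s v \<noteq> 0"
  shows "weight_eval s (param_eval \<sigma> p) = param_eval (\<lambda>v. weight_eval s (\<sigma> v)) p"
  by (simp add: param_eval_def weight_eval_sum weight_eval_mult[OF assms] weight_eval_prod[OF assms]
    weight_eval_power[OF assms] weight_eval_of_int)

section \<open>Solving for the weights\<close>

text \<open>A non-zero coefficient at a positive index forces a root to exist, and the constant
  coefficient keeps it away from zero.\<close>

lemma alg_closed_root:
  fixes p :: "'k::alg_closed_field poly"
  assumes "coeff p 0 \<noteq> 0" "coeff p i \<noteq> 0" "i > 0"
  obtains x where "x \<noteq> 0" "poly p x = 0"
proof -
  have "degree p > 0" using le_degree[OF assms(2)] assms(3) by simp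
  then obtain x where "poly p x = 0" using alg_closed_imp_poly_has_root by blast
  moreover have "x \<noteq> 0" using calculation assms(1) by (auto simp: poly_0_coeff_0)
  ultimately show thesis using that by blast
qed

lemma ex_laurent_root:
  fixes \<alpha> \<beta> \<delta> :: "'k::alg_closed_field"
  assumes "\<alpha> \<noteq> 0" "\<beta> \<noteq> 0"
  obtains x where "x \<noteq> 0" "(x / \<alpha> + \<alpha> / x) * (\<beta> / x + x / \<beta>) = \<delta>"
proof -
  \<comment> \<open>Multiplying the equation by \<open>\<alpha> * \<beta> * x^2\<close> leaves a
    monic quadratic in \<open>x^2\<close> with constant term
    \<open>\<alpha>^2 * \<beta>^2\<close>.\<close>
  obtain x where x: "x \<noteq> 0" "poly [:\<alpha>^2 * \<beta>^2, 0, \<alpha>^2 + \<beta>^2 - \<delta> * \<alpha> * \<beta>, 0, 1:] x = 0"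
    by (rule alg_closed_root[of "[:\<alpha>^2 * \<beta>^2, 0, \<alpha>^2 + \<beta>^2 - \<delta> * \<alpha> * \<beta>, 0, 1:]" 4])
      (use assms in \<open>auto simp: eval_nat_numeral\<close>)
  have "(x^2 + \<alpha>^2) * (x^2 + \<beta>^2) = \<delta> * (\<alpha> * \<beta> * x^2)"
    using x(2) by (simp add: algebra_simps power2_eq_square)
  moreover have "(x / \<alpha> + \<alpha> / x) * (\<beta> / x + x / \<beta>) = (x^2 + \<alpha>^2) * (x^2 + \<beta>^2) / (\<alpha> * \<beta> * x^2)"
    using x(1) assms by (simp add: field_simps power2_eq_square)
  ultimately have "(x / \<alpha> + \<alpha> / x) * (\<beta> / x + x / \<beta>) = \<delta>"
    using x(1) assms by simp
  with x(1) show thesis using that by blast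
qed

text \<open>The four factors belong to \<open>a\<close>, \<open>b = p / a\<close>,
  \<open>c = m * a / (p * r)\<close> and \<open>d = r / a\<close>, in this order, which is the
  solution of \<open>ab = p\<close>, \<open>ad = r\<close>, \<open>abcd = m\<close> for given
  \<open>a\<close>.\<close>

lemma ex_laurent_root4:
  fixes p r m \<delta> :: "'k::alg_closed_field"
  assumes "p \<noteq> 0" "r \<noteq> 0" "m \<noteq> 0"
  obtains a where "a \<noteq> 0"
    "(a + 1 / a) * (p / a + a / p) * (m * a / (p * r) + p * r / (m * a)) * (r / a + a / r) = \<delta>"
proof -
  \<comment> \<open>With its denominator cleared, each factor is linear in \<open>A = a^2\<close>,
    and the denominators multiply to \<open>m * p^2 * r^2 * A^2\<close>. The subtracted term sits in
    degree 2, so the constant term \<open>p^4 * r^4\<close> and the coefficient \<open>m^2\<close>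
    in degree 4 are not affected by \<open>\<delta>\<close>.\<close>
  let ?P = "[:1, 1:] * [:p^2, 1:] * [:r^2, 1:] * [:p^2 * r^2, m^2:] - [:0, 0, \<delta> * m * p^2 * r^2:]"
  obtain A where A: "A \<noteq> 0" "poly ?P A = 0"
    by (rule alg_closed_root[of ?P 4]) (use assms in \<open>auto simp: eval_nat_numeral\<close>)
  obtain a where a: "a ^ 2 = A" using nth_root_exists[of 2 A] by auto
  have "a \<noteq> 0" using a A by auto
  have "(A + 1) * (A + p^2) * (A + r^2) * (m^2 * A + p^2 * r^2) = \<delta> * (m * p^2 * r^2 * A^2)"
    using A(2) by (simp add: algebra_simps power2_eq_square)
  moreover have "(a + 1 / a) * (p / a + a / p) * (m * a / (p * r) + p * r / (m * a)) * (r / a + a / r) =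
    (A + 1) * (A + p^2) * (A + r^2) * (m^2 * A + p^2 * r^2) / (m * p^2 * r^2 * A^2)"
  proof -
    have e: "a + 1 / a = (A + 1) / a" "p / a + a / p = (A + p^2) / (a * p)" "r / a + a / r = (A + r^2) / (a * r)"
      "m * a / (p * r) + p * r / (m * a) = (m^2 * A + p^2 * r^2) / (m * a * p * r)"
      using \<open>a \<noteq> 0\<close> assms unfolding a[symmetric] by (simp_all add: field_simps power2_eq_square)
    have d: "m * p^2 * r^2 * A^2 = a * (a * p) * (m * a * p * r) * (a * r)"
      unfolding a[symmetric] by (simp add: power2_eq_square mult_ac)
    show ?thesis unfolding d e by (simp only: times_divide_times_eq mult_ac)
  qed
  ultimately have "(a + 1 / a) * (p / a + a / p) * (m * a / (p * r) + p * r / (m * a)) * (r / a + a / r) = \<delta>"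
    using A(1) assms by simp
  with \<open>a \<noteq> 0\<close> show thesis using that by blast
qed

lemma ex_weights:
  fixes pars :: "param \<Rightarrow> 'k::alg_closed_field"
  obtains wts :: "weight \<Rightarrow> 'k" where "\<And>v. wts v \<noteq> 0" "\<And>v. weight_eval wts (theta_val n v) = pars v"
proof -
  obtain t where t: "t \<noteq> 0" "poly [:1, 2 - pars PK, 1:] t = 0"
    by (rule alg_closed_root[of "[:1, 2 - pars PK, 1:]" 2]) (auto simp: eval_nat_numeral)
  have "t * (t + 2 + 1 / t) = t * pars PK" using t by (simp add: algebra_simps)
  then have tK: "t + 2 + 1 / t = pars PK" using t(1) by simp
  \<comment> \<open>The ratio in \<open>theta_val n PK\<close> is \<open>xy / zw\<close> for odd
    \<open>n\<close> and \<open>abcd / xyzw\<close> for even \<open>n\<close>. With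
    \<open>zw\<close> normalised to 1, the value \<open>t\<close> is assigned to
    \<open>u = xy\<close> or to \<open>m = abcd\<close>, and the other of the two is 1.\<close>
  define u m where "u = (if odd n then t else 1)" and "m = (if odd n then 1 else t)"
  have nz: "u \<noteq> 0" "m \<noteq> 0" using t by (auto simp: u_def m_def)
  obtain x where x: "x \<noteq> 0" "(x / 1 + 1 / x) * (u / x + x / u) = pars PDL"
    using ex_laurent_root[of 1 u] nz by (metis one_neq_zero)
  obtain z where z: "z \<noteq> 0" "(z / 1 + 1 / z) * (1 / z + z / 1) = pars PDR"
    using ex_laurent_root[of 1 1] by (metis one_neq_zero)
  define y w where "y = u / x" and "w = 1 / z"
  have yw: "y \<noteq> 0" "w \<noteq> 0" using x z nz by (auto simp: y_def w_def)
  \<comment> \<open>From \<open>ab = p\<close> and \<open>abcd = m\<close> follows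
    \<open>cd = m / p\<close>, so the second factor of the equation for K_L is one in
    \<open>p\<close> and \<open>m / y\<close>. Likewise \<open>bc = m / r\<close> for K_R.\<close>
  obtain p where p: "p \<noteq> 0" "(p / x + x / p) * (m / y / p + p / (m / y)) = pars PKL"
    using ex_laurent_root[of x "m / y"] x yw nz by (metis divide_eq_0_iff)
  obtain r where r: "r \<noteq> 0" "(r / w + w / r) * (m / z / r + r / (m / z)) = pars PKR"
    using ex_laurent_root[of w "m / z"] z yw nz by (metis divide_eq_0_iff)
  obtain a where a: "a \<noteq> 0" "(a + 1 / a) * (p / a + a / p) * (m * a / (p * r) + p * r / (m * a)) * (r / a + a / r) = pars PD"
    using ex_laurent_root4[of p r m] p r nz by metis
  define wts where "wts v = (case v of Wa \<Rightarrow> a | Wb \<Rightarrow> p / a | Wc \<Rightarrow> m * a / (p * r) | Wd \<Rightarrow> r / a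
    | Wx \<Rightarrow> x | Wy \<Rightarrow> y | Wz \<Rightarrow> z | Ww \<Rightarrow> w)" for v
  have W: "wts v \<noteq> 0" for v
    using a p r x z yw nz by (cases v) (auto simp: wts_def)
  have "weight_eval wts (theta_val n v) = pars v" for v
  proof (cases v)
    case PD
    then show ?thesis
      using a by (simp add: weight_eval_add weight_eval_mult[OF W] weight_eval_simps) (simp add: wts_def)
  next
    case PDL
    then show ?thesis
      using x by (simp add: weight_eval_add weight_eval_mult[OF W] weight_eval_simps) (simp add: wts_def y_def)
  next
    case PDR
    then show ?thesis
      using z by (simp add: weight_eval_add weight_eval_mult[OF W] weight_eval_simps) (simp add: wts_def w_def)
  next
    case PKL
    have "weight_eval wts (theta_val n PKL) = (p / x + x / p) * (m / y / p + p / (m / y))"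
      using a(1) p(1) r(1) x(1) yw nz
      by (simp add: weight_eval_add weight_eval_mult[OF W] weight_eval_simps) (simp add: wts_def mult_ac)
    with PKL p show ?thesis by simp
  next
    case PKR
    have "weight_eval wts (theta_val n PKR) = (r / w + w / r) * (m / z / r + r / (m / z))"
      using a(1) p(1) r(1) z(1) yw nz
      by (simp add: weight_eval_add weight_eval_mult[OF W] weight_eval_simps) (simp add: wts_def mult_ac)
    with PKR r show ?thesis by simp
  next
    case PK
    have "weight_eval wts (theta_val n PK) = t + 2 + 1 / t"
      using a(1) p(1) r(1) z(1) x(1) t(1)
      by (simp add: weight_eval_add weight_eval_mult[OF W] weight_eval_simps)
        (simp add: wts_def y_def w_def u_def m_def)
    with PK tK show ?thesis by simp
  qed
  with W that show thesis by blast
qed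

section \<open>Rank one operators on pairs of sites\<close>

text \<open>A vector is described by its coordinates at configurations, in which \<open>True\<close> stands for the
  basis vector \<open>v\<^sub>1\<close> and \<open>False\<close> for \<open>v\<^sub>2\<close>. On the span of \<open>12\<close> and \<open>21\<close> at the sites \<open>i\<close>, \<open>j\<close>, the
  operator \<open>R\<^sup>q\<close> is the product of the column \<open>(q, 1)\<close> and the row \<open>(1, 1/q)\<close>.\<close>

definition link_wt :: "'k::field \<Rightarrow> 's \<Rightarrow> 's \<Rightarrow> ('s \<Rightarrow> bool) \<Rightarrow> 'k" where
  "link_wt q i j \<beta> = (if \<beta> i = \<beta> j then 0 else if \<beta> i then q else 1)"

definition link_op :: "'k::field \<Rightarrow> 's \<Rightarrow> 's \<Rightarrow> (('s \<Rightarrow> bool) \<Rightarrow> 'k) \<Rightarrow> ('s \<Rightarrow> bool) \<Rightarrow> 'k" where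
  "link_op q i j v \<beta> =
     link_wt q i j \<beta> * (v (\<beta>(i := True, j := False)) + v (\<beta>(i := False, j := True)) / q)"

text \<open>The constant is the row \<open>(1, 1/q)\<close> applied to the column
  \<open>(q, 1)\<close>.\<close>

lemma link_op_idem:
  assumes "i \<noteq> j" "q \<noteq> 0"
  shows "link_op q i j (link_op q i j v) = (\<lambda>\<beta>. (q + 1 / q) * link_op q i j v \<beta>)"
  using assms by (auto simp: fun_eq_iff link_op_def link_wt_def field_simps)

lemma link_op_scale: "link_op q i j (\<lambda>\<beta>. c * v \<beta>) = (\<lambda>\<beta>. c * link_op q i j v \<beta>)"
  by (auto simp: fun_eq_iff link_op_def field_simps)

lemma link_op_commute:
  assumes "i \<noteq> j" "k \<noteq> l" "{i, j} \<inter> {k, l} = {}"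
  shows "link_op q i j (link_op r k l v) = link_op r k l (link_op q i j v)"
proof
  fix \<beta> 
  have "i \<noteq> k" "i \<noteq> l" "j \<noteq> k" "j \<noteq> l" using assms by auto
  then show "link_op q i j (link_op r k l v) \<beta> = link_op r k l (link_op q i j v) \<beta>"
    using assms(1,2)
    by (simp add: link_op_def link_wt_def field_simps fun_upd_twist)
qed

text \<open>Once the spin at the outer site \<open>k\<close> is fixed, a single sequence of
  intermediate configurations contributes, since the three sites have to alternate before and after
  the middle operator. Its weights are \<open>q\<close> and \<open>1 / q\<close>, which
  cancel.\<close>

lemma link_op_TL_left:
  assumes "i \<noteq> j" "j \<noteq> k" "i \<noteq> k" "q \<noteq> 0"
  shows "link_op q i j (link_op q j k (link_op q i j v)) = link_op q i j v"
proof
  fix \<beta> 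
  show "link_op q i j (link_op q j k (link_op q i j v)) \<beta> = link_op q i j v \<beta>"
    using assms
    by (cases "\<beta> k")
      (auto simp: link_op_def link_wt_def field_simps fun_upd_twist fun_upd_idem)
qed

lemma link_op_TL_right:
  assumes "i \<noteq> j" "j \<noteq> k" "i \<noteq> k" "q \<noteq> 0"
  shows "link_op q j k (link_op q i j (link_op q j k v)) = link_op q j k v"
proof
  fix \<beta> 
  show "link_op q j k (link_op q i j (link_op q j k v)) \<beta> = link_op q j k v \<beta>"
    using assms
    by (cases "\<beta> i")
      (auto simp: link_op_def link_wt_def field_simps fun_upd_twist fun_upd_idem)
qed

text \<open>On the four sites the two outer links form a rank one operator, so whatever stands
  between two copies of it contributes a scalar. Only the two alternating configurations survive:
  the one with \<open>True\<close> at \<open>i\<close> gives \<open>p * q / r\<close>, the other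
  \<open>r / (p * q)\<close>.\<close>

lemma link_op_bridge:
  assumes "distinct [i, j, k, l]" "p \<noteq> 0" "q \<noteq> 0" "r \<noteq> 0"
  shows "link_op p i j (link_op q k l (link_op r j k (link_op p i j (link_op q k l v)))) =
    (\<lambda>\<beta>. (p * q / r + r / (p * q)) * link_op p i j (link_op q k l v) \<beta>)"
proof -
  have ne: "i \<noteq> j" "j \<noteq> i" "i \<noteq> k" "k \<noteq> i" "i \<noteq> l" "l \<noteq> i" "j \<noteq> k" "k \<noteq> j" "j \<noteq> l" "l \<noteq> j" "k \<noteq> l" "l \<noteq> k"
    using assms(1) by auto
  \<comment> \<open>At this configuration both columns have the entry 1, so \<open>g\<close> is the
    coefficient of the product of the columns; it does not depend on the spins at the four
    sites.\<close>
  define g where "g \<beta> = link_op p i j (link_op q k l v) (\<beta>(i := False, j := True, k := False, l := True))" for \<beta>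
  have w: "link_op p i j (link_op q k l v) = (\<lambda>\<beta>. link_wt p i j \<beta> * link_wt q k l \<beta> * g \<beta>)"
    using assms by (auto simp: fun_eq_iff link_op_def link_wt_def g_def fun_upd_twist field_simps)
  have g: "g (\<beta>(i := b)) = g \<beta>" "g (\<beta>(j := b)) = g \<beta>" "g (\<beta>(k := b)) = g \<beta>" "g (\<beta>(l := b)) = g \<beta>"
    for b \<beta> using assms(1) by (simp_all add: g_def fun_upd_twist)
  have "link_op p i j (link_op q k l (link_op r j k (\<lambda>\<beta>. link_wt p i j \<beta> * link_wt q k l \<beta> * g \<beta>))) \<beta> =
    (p * q / r + r / (p * q)) * (link_wt p i j \<beta> * link_wt q k l \<beta> * g \<beta>)" for \<beta>
    using assms(2-4)
    by (cases "\<beta> i"; cases "\<beta> j"; cases "\<beta> k"; cases "\<beta> l")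
      (simp_all add: link_op_def link_wt_def g ne field_simps)
  then show ?thesis unfolding w by (rule ext)
qed

section \<open>Products of disjoint links\<close>

type_synonym ('k, 's) link = "'k \<times> 's \<times> 's"

definition links_op :: "('k::field, 's) link list \<Rightarrow> (('s \<Rightarrow> bool) \<Rightarrow> 'k) \<Rightarrow> ('s \<Rightarrow> bool) \<Rightarrow> 'k" where
  "links_op L = foldr (\<lambda>(q, i, j). link_op q i j) L"

lemma links_op_simps [simp]:
  "links_op [] v = v"
  "links_op ((q, i, j) # L) v = link_op q i j (links_op L v)"
  "links_op (L @ L') v = links_op L (links_op L' v)"
  by (simp_all add: links_op_def)

lemma links_op_scale: "links_op L (\<lambda>\<beta>. c * v \<beta>) = (\<lambda>\<beta>. c * links_op L v \<beta>)"
  by (induction L) (auto simp: link_op_scale)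

text \<open>Kept as a list, so that \<open>distinct\<close> says at once that each link joins two
  different sites and that the links are pairwise disjoint.\<close>

definition sites :: "('k, 's) link list \<Rightarrow> 's list" where
  "sites L = concat (map (\<lambda>(q, i, j). [i, j]) L)"

lemma sites_simps [simp]:
  "sites [] = []" "sites ((q, i, j) # L) = i # j # sites L" "sites (L @ L') = sites L @ sites L'"
  by (simp_all add: sites_def)

lemma link_op_links_op_commute:
  assumes "i \<noteq> j" "distinct (sites L)" "{i, j} \<inter> set (sites L) = {}"
  shows "link_op q i j (links_op L v) = links_op L (link_op q i j v)"
  using assms(2,3)
proof (induction L)
  case (Cons x L)
  obtain r k l where [simp]: "x = (r, k, l)" by (cases x)
  have "link_op q i j (links_op (x # L) v) = link_op r k l (link_op q i j (links_op L v))"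
    using link_op_commute[of i j k l q r "links_op L v"] Cons.prems assms(1) by simp
  with Cons show ?case by simp
qed simp

lemma links_op_commute:
  assumes "distinct (sites L)" "distinct (sites M)" "set (sites L) \<inter> set (sites M) = {}"
  shows "links_op L (links_op M v) = links_op M (links_op L v)"
  using assms(1,3)
proof (induction L)
  case (Cons x L)
  obtain r k l where [simp]: "x = (r, k, l)" by (cases x)
  show ?case
    using Cons link_op_links_op_commute[of k l M r "links_op L v"] assms(2) by simp
qed simp

text \<open>For disjoint links, the inputs that can contribute to the output at
  \<open>\<beta>\<close>.\<close>

definition alternations :: "('k, 's) link list \<Rightarrow> ('s \<Rightarrow> bool) \<Rightarrow> ('s \<Rightarrow> bool) set" where
  "alternations L \<beta> = {\<alpha>. (\<forall>s. s \<notin> set (sites L) \<longrightarrow> \<alpha> s = \<beta> s) \<and> (\<forall>(q, i, j) \<in> set L. \<alpha> i \<noteq> \<alpha> j)}"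

text \<open>Column entry of a product of disjoint links; \<open>in_wt\<close> is the row entry. The
  vanishing of the row at non-alternating configurations is not encoded in \<open>in_wt\<close> but
  left to the range \<open>alternations\<close> of the sums.\<close>

definition out_wt :: "('k::field, 's) link list \<Rightarrow> ('s \<Rightarrow> bool) \<Rightarrow> 'k" where
  "out_wt L \<beta> = (\<Prod>(q, i, j)\<leftarrow>L. link_wt q i j \<beta>)"

definition in_wt :: "('k::field, 's) link list \<Rightarrow> ('s \<Rightarrow> bool) \<Rightarrow> 'k" where
  "in_wt L \<alpha> = (\<Prod>(q, i, j)\<leftarrow>L. if \<alpha> i then 1 else 1 / q)"

lemma weights_upd:
  assumes "s \<notin> set (sites L)"
  shows "out_wt L (\<beta>(s := b)) = out_wt L \<beta>" "in_wt L (\<beta>(s := b)) = in_wt L \<beta>"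
  using assms by (induction L) (auto simp: out_wt_def in_wt_def link_wt_def)

lemma alternations_Nil: "alternations [] \<beta> = {\<beta>}"
  by (auto simp: alternations_def)

lemma alternations_Cons:
  assumes "distinct (sites ((q, i, j) # L))"
  shows "alternations ((q, i, j) # L) \<beta> =
    alternations L (\<beta>(i := True, j := False)) \<union> alternations L (\<beta>(i := False, j := True))"
proof (rule Set.set_eqI)
  fix \<alpha>
  have nin: "i \<notin> set (sites L)" "j \<notin> set (sites L)" "i \<noteq> j" using assms by auto
  show "\<alpha> \<in> alternations ((q, i, j) # L) \<beta> \<longleftrightarrow> \<alpha> \<in> alternations L (\<beta>(i := True, j := False))
    \<union> alternations L (\<beta>(i := False, j := True))" (is "?l \<longleftrightarrow> ?r")
  proof
    assume ?l
    with nin show ?r by (cases "\<alpha> i") (auto simp: alternations_def)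
  next
    assume ?r
    with nin show ?l by (auto simp: alternations_def split: if_splits)
  qed
qed

lemma finite_alternations: "distinct (sites L) \<Longrightarrow> finite (alternations L \<beta>)"
proof (induction L arbitrary: \<beta>)
  case (Cons x L)
  obtain q i j where [simp]: "x = (q, i, j)" by (cases x)
  from Cons show ?case by (simp add: alternations_Cons)
qed (simp add: alternations_Nil)

text \<open>Disjoint rank one operators multiply to a rank one operator on the union of their sites.
  In the induction the first pair splits the alternating configurations into two halves, on which
  its row contributes 1 and \<open>1 / q\<close>.\<close>

lemma links_op_eq_sum:
  assumes "distinct (sites L)"
  shows "links_op L v \<beta> = out_wt L \<beta> * (\<Sum>\<alpha>\<in>alternations L \<beta>. in_wt L \<alpha> * v \<alpha>)"
  using assms
proof (induction L arbitrary: \<beta>)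
  case Nil
  show ?case by (simp add: alternations_Nil out_wt_def in_wt_def)
next
  case (Cons x L)
  obtain q i j where x [simp]: "x = (q, i, j)" by (cases x)
  define \<beta>1 \<beta>2 where "\<beta>1 = \<beta>(i := True, j := False)" and "\<beta>2 = \<beta>(i := False, j := True)"
  have nin: "i \<notin> set (sites L)" "j \<notin> set (sites L)" "i \<noteq> j" "distinct (sites L)"
    using Cons.prems by auto
  have out: "out_wt L \<beta>1 = out_wt L \<beta>" "out_wt L \<beta>2 = out_wt L \<beta>"
    using nin by (simp_all add: \<beta>1_def \<beta>2_def weights_upd)
  have v1: "\<alpha> i" "\<not> \<alpha> j" if "\<alpha> \<in> alternations L \<beta>1" for \<alpha>
    using that nin by (auto simp: alternations_def \<beta>1_def)
  have v2: "\<not> \<alpha> i" "\<alpha> j" if "\<alpha> \<in> alternations L \<beta>2" for \<alpha>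
    using that nin by (auto simp: alternations_def \<beta>2_def)
  have "(\<Sum>\<alpha>\<in>alternations (x # L) \<beta>. in_wt (x # L) \<alpha> * v \<alpha>) =
      (\<Sum>\<alpha>\<in>alternations L \<beta>1. in_wt (x # L) \<alpha> * v \<alpha>) + (\<Sum>\<alpha>\<in>alternations L \<beta>2. in_wt (x # L) \<alpha> * v \<alpha>)"
    unfolding x \<beta>1_def \<beta>2_def
    by (subst alternations_Cons, use Cons.prems in simp, rule sum.union_disjoint)
      (use nin v1 v2 in \<open>auto simp: finite_alternations \<beta>1_def \<beta>2_def\<close>)
  also have "(\<Sum>\<alpha>\<in>alternations L \<beta>1. in_wt (x # L) \<alpha> * v \<alpha>) = (\<Sum>\<alpha>\<in>alternations L \<beta>1. in_wt L \<alpha> * v \<alpha>)"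
    by (rule sum.cong) (auto simp: in_wt_def v1)
  also have "(\<Sum>\<alpha>\<in>alternations L \<beta>2. in_wt (x # L) \<alpha> * v \<alpha>) =
      (\<Sum>\<alpha>\<in>alternations L \<beta>2. in_wt L \<alpha> * v \<alpha>) / q"
    unfolding sum_divide_distrib by (rule sum.cong) (auto simp: in_wt_def v2)
  finally have "out_wt (x # L) \<beta> * (\<Sum>\<alpha>\<in>alternations (x # L) \<beta>. in_wt (x # L) \<alpha> * v \<alpha>) =
     link_wt q i j \<beta> * (links_op L v \<beta>1 + links_op L v \<beta>2 / q)"
    using Cons.IH[OF nin(4), of \<beta>1] Cons.IH[OF nin(4), of \<beta>2] out
    by (simp add: out_wt_def algebra_simps add_divide_distrib)
  then show ?case
    by (simp add: link_op_def \<beta>1_def \<beta>2_def)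
qed

lemma out_wt_eq_0: "\<exists>(q, i, j) \<in> set L. \<alpha> i = \<alpha> j \<Longrightarrow> out_wt L \<alpha> = 0"
  by (force simp: out_wt_def prod_list_zero_iff link_wt_def)

text \<open>On each of the two alternating configurations of the ring, all links of one matching are
  oriented alike, so only these extreme values of the weights enter the sandwich relation.\<close>

lemma out_wt_True:
  "(\<forall>(q, i, j) \<in> set L. \<alpha> i \<and> \<not> \<alpha> j) \<Longrightarrow> out_wt L \<alpha> = prod_list (map fst L)"
  "(\<forall>(q, i, j) \<in> set L. \<alpha> i \<and> \<not> \<alpha> j) \<Longrightarrow> in_wt L \<alpha> = 1"
  by (induction L) (auto simp: out_wt_def in_wt_def link_wt_def)

lemma out_wt_False:
  "(\<forall>(q, i, j) \<in> set L. \<not> \<alpha> i \<and> \<alpha> j) \<Longrightarrow> out_wt L \<alpha> = 1"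
  "(\<forall>(q, i, j) \<in> set L. \<not> \<alpha> i \<and> \<alpha> j) \<Longrightarrow> in_wt L \<alpha> = 1 / prod_list (map fst L)"
  by (induction L) (auto simp: out_wt_def in_wt_def link_wt_def)

text \<open>\<open>L\<close> and \<open>M\<close> stand for the two matchings. The row of one meets
  the column of the other only at \<open>\<tau>\<close> and its complement. With \<open>l\<close>
  and \<open>m\<close> the products of the parameters, the row of \<open>L\<close> on the column of
  \<open>M\<close> gives \<open>1 + m / l\<close>, the row of \<open>M\<close> on the column of
  \<open>L\<close> gives \<open>1 + l / m\<close>, and these numbers multiply to
  \<open>s + 2 + 1 / s\<close>.\<close>

lemma links_op_sandwich:
  fixes L M :: "('k::field, 's) link list"
  assumes distL: "distinct (sites L)" and distM: "distinct (sites M)"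
    and sites: "set (sites L) = set (sites M)" "L \<noteq> []"
    and \<tau>: "\<And>\<alpha>. (\<forall>(q, i, j) \<in> set L \<union> set M. \<alpha> i \<noteq> \<alpha> j) \<longleftrightarrow>
              (\<forall>s\<in>set (sites L). \<alpha> s = \<tau> s) \<or> (\<forall>s\<in>set (sites L). \<alpha> s = (\<not> \<tau> s))"
    and \<tau>L: "\<forall>(q, i, j) \<in> set L. \<tau> i \<and> \<not> \<tau> j" and \<tau>M: "\<forall>(q, i, j) \<in> set M. \<not> \<tau> i \<and> \<tau> j"
    and nz: "prod_list (map fst L) \<noteq> 0" "prod_list (map fst M) \<noteq> 0"
  defines "s \<equiv> prod_list (map fst L) / prod_list (map fst M)"
  shows "links_op L (links_op M (links_op L v)) = (\<lambda>\<beta>. (s + 2 + 1 / s) * links_op L v \<beta>)"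
    and "links_op M (links_op L (links_op M v)) = (\<lambda>\<beta>. (s + 2 + 1 / s) * links_op M v \<beta>)"
proof -
  define S where "S = set (sites L)"
  have "S \<noteq> {}" using sites(2) by (cases L) (auto simp: S_def)
  \<comment> \<open>Off the common sites neither operator changes the configuration, so
    \<open>\<beta>\<close> is kept there.\<close>
  define \<tau>1 \<tau>2 where "\<tau>1 = (\<lambda>\<beta> s. if s \<in> S then \<tau> s else \<beta> s)"
    and "\<tau>2 = (\<lambda>\<beta> s. if s \<in> S then \<not> \<tau> s else \<beta> s)"
  have neq: "\<tau>1 \<beta> \<noteq> \<tau>2 \<beta>" for \<beta>
    using \<open>S \<noteq> {}\<close> by (auto simp: \<tau>1_def \<tau>2_def fun_eq_iff)
  have in_sites: "i \<in> set (sites N)" "j \<in> set (sites N)" if "(q, i, j) \<in> set N" for q i j N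
    using that by (force simp: sites_def)+
  have int: "alternations L \<beta> \<inter> {\<alpha>. \<forall>(q, i, j) \<in> set M. \<alpha> i \<noteq> \<alpha> j} = {\<tau>1 \<beta>, \<tau>2 \<beta>}"
    "alternations M \<beta> \<inter> {\<alpha>. \<forall>(q, i, j) \<in> set L. \<alpha> i \<noteq> \<alpha> j} = {\<tau>1 \<beta>, \<tau>2 \<beta>}" for \<beta>
  proof -
    have S: "S = set (sites L)" "S = set (sites M)" using sites(1) by (simp_all add: S_def)
    have *: "{\<alpha>. (\<forall>s. s \<notin> S \<longrightarrow> \<alpha> s = \<beta> s) \<and> (\<forall>(q, i, j) \<in> set L \<union> set M. \<alpha> i \<noteq> \<alpha> j)} = {\<tau>1 \<beta>, \<tau>2 \<beta>}"
      unfolding \<tau> S_def[symmetric] by (auto simp: \<tau>1_def \<tau>2_def fun_eq_iff)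
    show "alternations L \<beta> \<inter> {\<alpha>. \<forall>(q, i, j) \<in> set M. \<alpha> i \<noteq> \<alpha> j} = {\<tau>1 \<beta>, \<tau>2 \<beta>}"
      unfolding *[symmetric] alternations_def S(1)
      by (intro Set.set_eqI iffI; simp only: Int_iff mem_Collect_eq ball_Un; elim conjE; intro conjI; assumption)
    show "alternations M \<beta> \<inter> {\<alpha>. \<forall>(q, i, j) \<in> set L. \<alpha> i \<noteq> \<alpha> j} = {\<tau>1 \<beta>, \<tau>2 \<beta>}"
      unfolding *[symmetric] alternations_def S(2)
      by (intro Set.set_eqI iffI; simp only: Int_iff mem_Collect_eq ball_Un; elim conjE; intro conjI; assumption)
  qed
  let ?l = "prod_list (map fst L)" and ?m = "prod_list (map fst M)"
  have \<tau>1: "\<tau>1 \<beta> x = \<tau> x" "\<tau>2 \<beta> x = (\<not> \<tau> x)" if "x \<in> S" for \<beta> x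
    using that by (auto simp: \<tau>1_def \<tau>2_def)
  have inS: "i \<in> S \<and> j \<in> S" if "(q, i, j) \<in> set L \<union> set M" for q i j
    using that in_sites[of q i j L] in_sites[of q i j M] sites(1) unfolding S_def by blast
  have "(\<forall>(q, i, j) \<in> set L. \<tau>1 \<beta> i \<and> \<not> \<tau>1 \<beta> j)" "(\<forall>(q, i, j) \<in> set L. \<not> \<tau>2 \<beta> i \<and> \<tau>2 \<beta> j)"
    "(\<forall>(q, i, j) \<in> set M. \<not> \<tau>1 \<beta> i \<and> \<tau>1 \<beta> j)" "(\<forall>(q, i, j) \<in> set M. \<tau>2 \<beta> i \<and> \<not> \<tau>2 \<beta> j)" for \<beta>
    using \<tau>L \<tau>M inS \<tau>1 by (fast)+
  note w = this(1)[THEN out_wt_True(1)] this(1)[THEN out_wt_True(2)]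
    this(2)[THEN out_wt_False(1)] this(2)[THEN out_wt_False(2)]
    this(3)[THEN out_wt_False(1)] this(3)[THEN out_wt_False(2)]
    this(4)[THEN out_wt_True(1)] this(4)[THEN out_wt_True(2)]
  have z: "out_wt N \<alpha> = 0" if "\<alpha> \<notin> {\<alpha>. \<forall>(q, i, j) \<in> set N. \<alpha> i \<noteq> \<alpha> j}"
    for \<alpha> and N :: "('k, 's) link list"
    using that out_wt_eq_0[of N \<alpha>] by auto
  have sumL: "(\<Sum>\<alpha>\<in>alternations L \<beta>. in_wt L \<alpha> * out_wt M \<alpha>) = 1 + ?m / ?l" for \<beta>
  proof -
    have "(\<Sum>\<alpha>\<in>alternations L \<beta>. in_wt L \<alpha> * out_wt M \<alpha>) =
      (\<Sum>\<alpha>\<in>alternations L \<beta> \<inter> {\<alpha>. \<forall>(q, i, j) \<in> set M. \<alpha> i \<noteq> \<alpha> j}. in_wt L \<alpha> * out_wt M \<alpha>)"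
      by (rule sum.mono_neutral_right[OF finite_alternations[OF distL] Int_lower1], rule ballI, subst z, blast, simp)
    also have "\<dots> = 1 + ?m / ?l" unfolding int using neq by (simp add: w)
    finally show ?thesis .
  qed
  have sumM: "(\<Sum>\<alpha>\<in>alternations M \<beta>. in_wt M \<alpha> * out_wt L \<alpha>) = 1 + ?l / ?m" for \<beta>
  proof -
    have "(\<Sum>\<alpha>\<in>alternations M \<beta>. in_wt M \<alpha> * out_wt L \<alpha>) =
      (\<Sum>\<alpha>\<in>alternations M \<beta> \<inter> {\<alpha>. \<forall>(q, i, j) \<in> set L. \<alpha> i \<noteq> \<alpha> j}. in_wt M \<alpha> * out_wt L \<alpha>)"
      by (rule sum.mono_neutral_right[OF finite_alternations[OF distM] Int_lower1], rule ballI, subst z, blast, simp)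
    also have "\<dots> = 1 + ?l / ?m" unfolding int using neq by (simp add: w)
    finally show ?thesis .
  qed
  \<comment> \<open>\<open>L\<close> and \<open>M\<close> have the same sites, so the alternating
    configurations depend only on the spins off these sites; inner sums are therefore constant along
    the outer ones and can be pulled out.\<close>
  have mL: "alternations L \<alpha> = alternations L \<beta>" "alternations M \<alpha> = alternations M \<beta>"
    if "\<alpha> \<in> alternations L \<beta> \<or> \<alpha> \<in> alternations M \<beta>" for \<alpha> \<beta>
    using that sites by (auto simp: alternations_def)
  have K: "(1 + ?m / ?l) * (1 + ?l / ?m) = s + 2 + 1 / s"
    using nz by (simp add: s_def field_simps)
  have L_M: "links_op L (links_op M v) \<beta> =
      (1 + ?m / ?l) * (out_wt L \<beta> * (\<Sum>\<alpha>\<in>alternations M \<beta>. in_wt M \<alpha> * v \<alpha>))" for v \<beta>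
  proof -
    have "(\<Sum>\<alpha>\<in>alternations L \<beta>. in_wt L \<alpha> * links_op M v \<alpha>) =
      (\<Sum>\<alpha>\<in>alternations L \<beta>. in_wt L \<alpha> * out_wt M \<alpha>) * (\<Sum>\<alpha>\<in>alternations M \<beta>. in_wt M \<alpha> * v \<alpha>)"
      unfolding sum_distrib_right
      by (rule sum.cong) (auto simp: links_op_eq_sum[OF distM] mL(2)[of _ \<beta>])
    then show ?thesis by (simp add: links_op_eq_sum[OF distL] sumL algebra_simps)
  qed
  have M_L: "links_op M (links_op L v) \<beta> =
      (1 + ?l / ?m) * (out_wt M \<beta> * (\<Sum>\<alpha>\<in>alternations L \<beta>. in_wt L \<alpha> * v \<alpha>))" for v \<beta>
  proof -
    have "(\<Sum>\<alpha>\<in>alternations M \<beta>. in_wt M \<alpha> * links_op L v \<alpha>) =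
      (\<Sum>\<alpha>\<in>alternations M \<beta>. in_wt M \<alpha> * out_wt L \<alpha>) * (\<Sum>\<alpha>\<in>alternations L \<beta>. in_wt L \<alpha> * v \<alpha>)"
      unfolding sum_distrib_right
      by (rule sum.cong) (auto simp: links_op_eq_sum[OF distL] mL(1)[of _ \<beta>])
    then show ?thesis by (simp add: links_op_eq_sum[OF distM] sumM algebra_simps)
  qed
  have "links_op L (links_op M (links_op L v)) \<beta> = (s + 2 + 1 / s) * links_op L v \<beta>" for \<beta>
  proof -
    have "(\<Sum>\<alpha>\<in>alternations M \<beta>. in_wt M \<alpha> * links_op L v \<alpha>) =
      (1 + ?l / ?m) * (\<Sum>\<alpha>\<in>alternations L \<beta>. in_wt L \<alpha> * v \<alpha>)"
      unfolding sumM[of \<beta>, symmetric] sum_distrib_right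
      by (rule sum.cong) (auto simp: links_op_eq_sum[OF distL] mL(1)[of _ \<beta>])
    then show ?thesis unfolding L_M K[symmetric] by (simp add: links_op_eq_sum[OF distL] mult_ac)
  qed
  then show "links_op L (links_op M (links_op L v)) = (\<lambda>\<beta>. (s + 2 + 1 / s) * links_op L v \<beta>)" by auto
  have "links_op M (links_op L (links_op M v)) \<beta> = (s + 2 + 1 / s) * links_op M v \<beta>" for \<beta>
  proof -
    have "(\<Sum>\<alpha>\<in>alternations L \<beta>. in_wt L \<alpha> * links_op M v \<alpha>) =
      (1 + ?m / ?l) * (\<Sum>\<alpha>\<in>alternations M \<beta>. in_wt M \<alpha> * v \<alpha>)"
      unfolding sumL[of \<beta>, symmetric] sum_distrib_right
      by (rule sum.cong) (auto simp: links_op_eq_sum[OF distM] mL(2)[of _ \<beta>])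
    then show ?thesis unfolding M_L K[symmetric] by (simp add: links_op_eq_sum[OF distM] mult_ac)
  qed
  then show "links_op M (links_op L (links_op M v)) = (\<lambda>\<beta>. (s + 2 + 1 / s) * links_op M v \<beta>)" by auto
qed

lemma links_op_idem:
  assumes "distinct (sites L)" "0 \<notin> fst ` set L"
  shows "links_op L (links_op L v) = (\<lambda>\<beta>. (\<Prod>q\<leftarrow>map fst L. q + 1 / q) * links_op L v \<beta>)"
  using assms
proof (induction L)
  case (Cons x L)
  obtain q i j where [simp]: "x = (q, i, j)" by (cases x)
  have "links_op (x # L) (links_op (x # L) v) = link_op q i j (link_op q i j (links_op L (links_op L v)))"
    using Cons.prems link_op_links_op_commute[of i j L q "links_op L v"] by simp
  also have "\<dots> = (\<lambda>\<beta>. (\<Prod>q\<leftarrow>map fst L. q + 1 / q) * ((q + 1 / q) * link_op q i j (links_op L v) \<beta>))"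
  proof -
    have "links_op L (links_op L v) = (\<lambda>\<beta>. (\<Prod>q\<leftarrow>map fst L. q + 1 / q) * links_op L v \<beta>)"
      using Cons by simp
    then show ?thesis unfolding link_op_scale[symmetric]
      using Cons.prems by (simp add: link_op_idem link_op_scale)
  qed
  also have "\<dots> = (\<lambda>\<beta>. (\<Prod>q\<leftarrow>map fst (x # L). q + 1 / q) * links_op (x # L) v \<beta>)"
    by (simp add: mult_ac)
  finally show ?case .
qed simp

text \<open>Links of different blocks commute, so the word regroups into one word per block and the
  constants multiply. Inside a block the links of \<open>L\<^sub>1\<close> and
  \<open>M\<^sub>1\<close> may share sites; that is where a relation takes place.\<close>

lemma links_op_block:
  assumes "distinct (sites L\<^sub>1)" "distinct (sites M\<^sub>1)" "distinct (sites L\<^sub>2)" "distinct (sites M\<^sub>2)"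
    and disj: "(set (sites L\<^sub>1) \<union> set (sites M\<^sub>1)) \<inter> (set (sites L\<^sub>2) \<union> set (sites M\<^sub>2)) = {}"
    and L1: "\<And>v. links_op (L\<^sub>1 @ M\<^sub>1 @ L\<^sub>1) v = (\<lambda>\<beta>. c\<^sub>1 * links_op L\<^sub>1 v \<beta>)"
    and L2: "\<And>v. links_op (L\<^sub>2 @ M\<^sub>2 @ L\<^sub>2) v = (\<lambda>\<beta>. c\<^sub>2 * links_op L\<^sub>2 v \<beta>)"
  shows "links_op ((L\<^sub>1 @ L\<^sub>2) @ (M\<^sub>1 @ M\<^sub>2) @ (L\<^sub>1 @ L\<^sub>2)) v = (\<lambda>\<beta>. (c\<^sub>1 * c\<^sub>2) * links_op (L\<^sub>1 @ L\<^sub>2) v \<beta>)"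
proof -
  have comm: "links_op L\<^sub>2 (links_op M\<^sub>1 u) = links_op M\<^sub>1 (links_op L\<^sub>2 u)"
    "links_op L\<^sub>2 (links_op L\<^sub>1 u) = links_op L\<^sub>1 (links_op L\<^sub>2 u)"
    "links_op M\<^sub>2 (links_op L\<^sub>1 u) = links_op L\<^sub>1 (links_op M\<^sub>2 u)" for u
    by (rule links_op_commute; use assms(1-4) disj in blast)+
  have "links_op ((L\<^sub>1 @ L\<^sub>2) @ (M\<^sub>1 @ M\<^sub>2) @ (L\<^sub>1 @ L\<^sub>2)) v =
    links_op (L\<^sub>1 @ M\<^sub>1 @ L\<^sub>1) (links_op (L\<^sub>2 @ M\<^sub>2 @ L\<^sub>2) v)"
    by (simp add: comm)
  then show ?thesis by (simp only: L1 L2) (simp add: links_op_scale mult_ac)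
qed

text \<open>The expression in \<open>links_op_eq_sum\<close> depends only on the multiset of the
  links.\<close>

lemma links_op_perm:
  assumes "mset L = mset M" "distinct (sites L)" "distinct (sites M)"
  shows "links_op L v = links_op M v"
proof
  fix \<beta>
  have prod: "prod_list (map f L) = prod_list (map f M)" for f :: "_ \<Rightarrow> 'a"
    using assms(1) by (metis mset_map prod_mset_prod_list)
  have "set L = set M" using assms(1) by (rule mset_eq_setD)
  then have "alternations L \<beta> = alternations M \<beta>" by (auto simp: alternations_def sites_def)
  then show "links_op L v \<beta> = links_op M v \<beta>"
    by (simp add: links_op_eq_sum assms out_wt_def in_wt_def prod)
qed

section \<open>The operators in coordinates\<close>

text \<open>Configurations are total functions on the integers, of which only the values at
  \<open>positions n\<close> enter. This frees the link operators from side conditions on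
  domains.\<close>

definition config :: "nat \<Rightarrow> (int \<Rightarrow> bool) \<Rightarrow> int \<Rightarrow> int" where
  "config n c = (\<lambda>k\<in>positions n. if c k then 1 else 2)"

definition coord :: "nat \<Rightarrow> ((int \<Rightarrow> int) \<Rightarrow>\<^sub>0 'k) \<Rightarrow> (int \<Rightarrow> bool) \<Rightarrow> 'k::zero" where
  "coord n v c = Poly_Mapping.lookup v (config n c)"

lemma config_eq_iff: "config n c = config n d \<longleftrightarrow> (\<forall>k\<in>positions n. c k = d k)"
  by (auto simp: config_def fun_eq_iff restrict_def split: if_splits)

lemma config_in_basis: "config n c \<in> basis_index n"
  by (auto simp: config_def basis_index_def)

lemma basis_index_config:
  assumes "\<alpha> \<in> basis_index n"
  shows "\<alpha> = config n (\<lambda>k. \<alpha> k = 1)"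
proof (rule extensionalityI[of _ "positions n"])
  show "\<alpha> \<in> extensional (positions n)" using assms by (auto simp: basis_index_def PiE_iff)
  show "config n (\<lambda>k. \<alpha> k = 1) \<in> extensional (positions n)" by (simp add: config_def)
  fix x assume "x \<in> positions n"
  then show "\<alpha> x = config n (\<lambda>k. \<alpha> k = 1) x"
    using assms by (auto simp: basis_index_def config_def PiE_iff)
qed

lemma coord_eqI:
  assumes "u \<in> tensor_space n" "v \<in> tensor_space n" "coord n u = coord n v"
  shows "u = v"
proof (rule poly_mapping_eqI)
  fix \<alpha>
  show "Poly_Mapping.lookup u \<alpha> = Poly_Mapping.lookup v \<alpha>"
  proof (cases "\<alpha> \<in> basis_index n")
    case True
    then show ?thesis
      using fun_cong[OF assms(3), of "\<lambda>k. \<alpha> k = 1"] by (simp add: coord_def flip: basis_index_config)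
  next
    case False
    then have "\<alpha> \<notin> Poly_Mapping.keys u" "\<alpha> \<notin> Poly_Mapping.keys v"
      using assms(1,2) by (auto simp: tensor_space_def)
    then show ?thesis by (simp add: in_keys_iff)
  qed
qed

lemma next_pos_in_positions: "i \<in> positions n \<Longrightarrow> next_pos n i \<in> positions n"
  by (auto simp: positions_def next_pos_def)

lemma next_pos_neq: "n \<ge> 1 \<Longrightarrow> next_pos n i \<noteq> i"
  by (auto simp: next_pos_def)

lemma R_basis_config:
  assumes "n \<ge> 1" "i \<in> positions n" "j = next_pos n i"
  shows "R_basis n q i (config n a) = (if a i = a j then 0 else
    Poly_Mapping.single (config n (a(i := True, j := False))) (if a i then q else 1) +
    Poly_Mapping.single (config n (a(i := False, j := True))) (if a i then 1 else 1 / q))"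
proof -
  have j: "j \<in> positions n" "i \<noteq> j"
    using assms next_pos_in_positions next_pos_neq[of n i] by auto
  have "(config n a)(i := 1, j := 2) = config n (a(i := True, j := False))"
    "(config n a)(i := 2, j := 1) = config n (a(i := False, j := True))"
    using j assms by (auto simp: config_def fun_eq_iff restrict_def)
  then show ?thesis
    using j assms(1,2)
    by (simp add: R_basis_def Let_def flip: assms(3))
      (auto simp: config_def power_int_minus divide_inverse)
qed

text \<open>\<open>R_basis\<close> gives the image of a basis vector, a column of the matrix,
  whereas \<open>link_op\<close> is stated for a fixed output \<open>c\<close>. The two updates of
  \<open>c\<close> are the only inputs that can reach it.\<close>

lemma coord_R_basis:
  assumes "n \<ge> 1" "i \<in> positions n" "j = next_pos n i" "q \<noteq> 0" "\<alpha> \<in> basis_index n"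
  shows "coord n (R_basis n q i \<alpha>) c = link_wt q i j c *
    ((if \<alpha> = config n (c(i := True, j := False)) then 1 else 0) +
     (if \<alpha> = config n (c(i := False, j := True)) then 1 / q else 0))"
proof -
  define a where "a = (\<lambda>k. \<alpha> k = 1)"
  have \<alpha>: "\<alpha> = config n a" unfolding a_def by (rule basis_index_config[OF assms(5)])
  have j: "j \<in> positions n" "i \<noteq> j" 
    using assms next_pos_in_positions next_pos_neq[of n i] by auto
  \<comment> \<open>Every equality of configurations that arises splits into agreement off
    \<open>i\<close> and \<open>j\<close> and a condition on these two sites.\<close>
  define off where "off \<longleftrightarrow> (\<forall>k\<in>positions n - {i, j}. a k = c k)"
  have "config n (a(i := x, j := y)) = config n c \<longleftrightarrow> off \<and> c i = x \<and> c j = y"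
    "config n a = config n (c(i := x, j := y)) \<longleftrightarrow> off \<and> a i = x \<and> a j = y" for x y
    unfolding config_eq_iff off_def using assms(2) j by auto
  then show ?thesis
    unfolding \<alpha> R_basis_config[OF assms(1-3)] coord_def
    using assms(4) by (auto simp: lookup_add lookup_single when_def link_wt_def)
qed

lemma R_basis_closed:
  assumes "n \<ge> 1" "i \<in> positions n" "\<alpha> \<in> basis_index n"
  shows "R_basis n q i \<alpha> \<in> tensor_space n"
proof -
  have "Poly_Mapping.single (config n c) x \<in> tensor_space n" for c and x :: 'a
    using config_in_basis by (auto simp: tensor_space_def)
  moreover obtain a where "\<alpha> = config n a" using basis_index_config[OF assms(3)] by blast
  ultimately show ?thesis
    by (auto simp: R_basis_config[OF assms(1,2) refl] intro!: tensor_space_closed)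
qed

lemma R_op_closed:
  assumes "n \<ge> 1" "i \<in> positions n" "v \<in> tensor_space n"
  shows "R_op n q i v \<in> tensor_space n"
proof -
  have "\<alpha> \<in> basis_index n" if "\<alpha> \<in> Poly_Mapping.keys v" for \<alpha>
    using that assms(3) by (auto simp: tensor_space_def)
  with assms show ?thesis
    by (auto simp: R_op_def intro!: tensor_space_sum tensor_space_closed R_basis_closed)
qed

lemma coord_R_op:
  assumes "n \<ge> 1" "i \<in> positions n" "q \<noteq> 0" "v \<in> tensor_space n"
  shows "coord n (R_op n q i v) = link_op q i (next_pos n i) (coord n v)"
proof
  fix c
  let ?j = "next_pos n i"
  have lk: "(\<Sum>\<alpha>\<in>Poly_Mapping.keys v. Poly_Mapping.lookup v \<alpha> * (if \<alpha> = \<beta> then x else 0)) =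
    Poly_Mapping.lookup v \<beta> * x" for \<beta> x
  proof -
    have "(\<Sum>\<alpha>\<in>Poly_Mapping.keys v. Poly_Mapping.lookup v \<alpha> * (if \<alpha> = \<beta> then x else 0)) =
      (\<Sum>\<alpha>\<in>Poly_Mapping.keys v. if \<alpha> = \<beta> then Poly_Mapping.lookup v \<beta> * x else 0)"
      by (rule sum.cong) auto
    then show ?thesis by (auto simp: in_keys_iff)
  qed
  have sub: "\<alpha> \<in> basis_index n" if "\<alpha> \<in> Poly_Mapping.keys v" for \<alpha>
    using that assms(4) by (auto simp: tensor_space_def)
  have "coord n (R_op n q i v) c =
    (\<Sum>\<alpha>\<in>Poly_Mapping.keys v. Poly_Mapping.lookup v \<alpha> * coord n (R_basis n q i \<alpha>) c)"
    using assms(4) by (simp add: R_op_def coord_def lookup_sum)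
  also have "\<dots> = (\<Sum>\<alpha>\<in>Poly_Mapping.keys v. link_wt q i ?j c *
    (Poly_Mapping.lookup v \<alpha> * (if \<alpha> = config n (c(i := True, ?j := False)) then 1 else 0) +
     Poly_Mapping.lookup v \<alpha> * (if \<alpha> = config n (c(i := False, ?j := True)) then 1 / q else 0)))"
    by (rule sum.cong[OF refl]) (simp only: coord_R_basis[OF assms(1,2) refl assms(3) sub] algebra_simps)
  also have "\<dots> = link_op q i ?j (coord n v) c"
    unfolding sum_distrib_left[symmetric] sum.distrib lk by (simp add: link_op_def coord_def)
  finally show "coord n (R_op n q i v) c = link_op q i ?j (coord n v) c" .
qed

lemma coord_add: "coord n (u + v) c = coord n u c + coord n v c"
  by (simp add: coord_def lookup_add)

lemma coord_scale: "coord n (scale x v) c = x * coord n v c"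
  by (simp add: coord_def)

lemma R_op_in_End:
  assumes "n \<ge> 1" "i \<in> positions n" "q \<noteq> 0"
  shows "R_op n q i \<in> carrier (End_space n)"
  unfolding End_space_iff
proof (intro conjI ballI allI)
  fix u v :: "(int \<Rightarrow> int) \<Rightarrow>\<^sub>0 'a" and x assume u: "u \<in> tensor_space n" and v: "v \<in> tensor_space n"
  show "R_op n q i (u + v) = R_op n q i u + R_op n q i v"
    by (rule coord_eqI[of _ n])
      (use u v assms in \<open>simp_all add: R_op_closed tensor_space_closed fun_eq_iff coord_add coord_R_op,
       simp add: link_op_def coord_add algebra_simps add_divide_distrib\<close>)
  show "R_op n q i (scale x v) = scale x (R_op n q i v)"
    by (rule coord_eqI[of _ n])
      (use v assms in \<open>simp_all add: R_op_closed tensor_space_closed fun_eq_iff coord_scale coord_R_op,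
       simp add: link_op_def coord_scale algebra_simps add_divide_distrib\<close>)
qed (use assms in \<open>simp_all add: R_op_closed\<close>, simp add: R_op_def)

definition represents ::
    "nat \<Rightarrow> (((int \<Rightarrow> int) \<Rightarrow>\<^sub>0 'k::field) \<Rightarrow> ((int \<Rightarrow> int) \<Rightarrow>\<^sub>0 'k)) \<Rightarrow> ('k, int) link list \<Rightarrow> bool" where
  "represents n T L \<longleftrightarrow> T \<in> carrier (End_space n) \<and>
     (\<forall>v\<in>tensor_space n. coord n (T v) = links_op L (coord n v))"

lemma represents_R_op:
  assumes "n \<ge> 1" "i \<in> positions n" "q \<noteq> 0"
  shows "represents n (R_op n q i) [(q, i, next_pos n i)]"
  using R_op_in_End[OF assms] coord_R_op[OF assms] by (simp add: represents_def)

lemma represents_mult: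
  assumes "represents n S L" "represents n T M"
  shows "represents n (S \<otimes>\<^bsub>End_space n\<^esub> T) (L @ M)"
  using assms
  by (auto simp: represents_def End_space_closed) (auto simp: End_space_simps compose_def End_space_iff)

lemma represents_one: "represents n \<one>\<^bsub>End_space n\<^esub> []"
  by (auto simp: represents_def End_space_const_closed) (simp add: End_space_simps)

section \<open>The relations of the symplectic blob algebra\<close>

fun gen_links :: "nat \<Rightarrow> (weight \<Rightarrow> 'k) \<Rightarrow> blob_gen \<Rightarrow> ('k, int) link list" where
  "gen_links n s (GU i) =
     [(s Wa, - int n - int i, next_pos n (- int n - int i)), (s Wb, - int n + int i, next_pos n (- int n + int i)),
      (s Wc, int n - int i, next_pos n (int n - int i)), (s Wd, int n + int i, next_pos n (int n + int i))]"
| "gen_links n s Ge = [(s Wx, - int n, next_pos n (- int n)), (s Wy, int n, next_pos n (int n))]"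
| "gen_links n s Gf = [(s Wz, 0, next_pos n 0), (s Ww, 2 * int n, next_pos n (2 * int n))]"

abbreviation word_links :: "nat \<Rightarrow> (weight \<Rightarrow> 'k) \<Rightarrow> blob_gen list \<Rightarrow> ('k, int) link list" where
  "word_links n s w \<equiv> concat (map (gen_links n s) w)"

lemma represents_R_gen:
  assumes "n \<ge> 1" "g \<in> blob_gens n" "\<And>v. s v \<noteq> 0"
  shows "represents n (R_gen n s g) (gen_links n s g)"
proof (cases g)
  case (GU i)
  with assms have i: "1 \<le> i" "i < n" by (auto simp: blob_gens_def)
  have p: "- int n - int i \<in> positions n" "- int n + int i \<in> positions n"
    "int n - int i \<in> positions n" "int n + int i \<in> positions n"
    using i by (auto simp: positions_def)
  have "represents n (R_gen n s g)
     ((([(s Wa, - int n - int i, next_pos n (- int n - int i))] @ [(s Wb, - int n + int i, next_pos n (- int n + int i))]) @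
      [(s Wc, int n - int i, next_pos n (int n - int i))]) @ [(s Wd, int n + int i, next_pos n (int n + int i))])"
    unfolding GU R_gen.simps by (intro represents_mult represents_R_op assms p)
  then show ?thesis by (simp add: GU)
next
  case Ge
  have p: "- int n \<in> positions n" "int n \<in> positions n" using assms(1) by (auto simp: positions_def)
  have "represents n (R_gen n s g)
     ([(s Wx, - int n, next_pos n (- int n))] @ [(s Wy, int n, next_pos n (int n))])"
    unfolding Ge R_gen.simps by (intro represents_mult represents_R_op assms p)
  then show ?thesis by (simp add: Ge)
next
  case Gf
  have p: "0 \<in> positions n" "2 * int n \<in> positions n" using assms(1) by (auto simp: positions_def)
  have "represents n (R_gen n s g)
     ([(s Wz, 0, next_pos n 0)] @ [(s Ww, 2 * int n, next_pos n (2 * int n))])"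
    unfolding Gf R_gen.simps by (intro represents_mult represents_R_op assms p)
  then show ?thesis by (simp add: Gf)
qed

definition R_word :: "nat \<Rightarrow> (weight \<Rightarrow> 'k::field) \<Rightarrow> blob_gen list \<Rightarrow> ((int \<Rightarrow> int) \<Rightarrow>\<^sub>0 'k) \<Rightarrow> ((int \<Rightarrow> int) \<Rightarrow>\<^sub>0 'k)" where
  "R_word n s w = foldr (\<lambda>g T. R_gen n s g \<otimes>\<^bsub>End_space n\<^esub> T) w \<one>\<^bsub>End_space n\<^esub>"

lemma represents_R_word:
  assumes "n \<ge> 1" "\<And>v. s v \<noteq> 0" "w \<in> lists (blob_gens n)"
  shows "represents n (R_word n s w) (word_links n s w)"
  using assms(3)
proof (induction w)
  case Nil
  show ?case by (simp add: R_word_def represents_one)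
next
  case (Cons g w)
  then have "represents n (R_gen n s g \<otimes>\<^bsub>End_space n\<^esub> R_word n s w) (gen_links n s g @ word_links n s w)"
    by (intro represents_mult represents_R_gen assms(1,2)) auto
  then show ?case by (simp add: R_word_def)
qed

lemma monoid_free_monoid: "monoid (free_monoid X)"
  by (rule monoidI) (auto simp: free_monoid_def)

lemma monoid_rep_R_word:
  fixes s :: "weight \<Rightarrow> 'k::field"
  assumes "n \<ge> 1" "\<And>v. s v \<noteq> 0" "scalar_hom \<eta>"
  shows "monoid_rep (free_monoid (blob_gens n)) \<eta> n (R_word n s)"
proof (intro monoid_rep.intro monoid_rep_axioms.intro monoid_free_monoid assms)
  have cl: "R_word n s w \<in> carrier (End_space n)" if "w \<in> lists (blob_gens n)" for w
    using represents_R_word[OF assms(1,2) that] by (simp add: represents_def)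
  then show "R_word n s w \<in> carrier (End_space n)" if "w \<in> carrier (free_monoid (blob_gens n))" for w
    using that by (simp add: free_monoid_def)
  show "R_word n s \<one>\<^bsub>free_monoid (blob_gens n)\<^esub> = \<one>\<^bsub>End_space n\<^esub>"
    by (simp add: free_monoid_def R_word_def)
  fix u w assume "u \<in> carrier (free_monoid (blob_gens n))" "w \<in> carrier (free_monoid (blob_gens n))"
  then have uw: "u \<in> lists (blob_gens n)" "w \<in> lists (blob_gens n)" by (simp_all add: free_monoid_def)
  interpret E: ring "End_space n :: ('k, _) module" by (rule ring_End_space)
  have "R_word n s (u @ w) = R_word n s u \<otimes>\<^bsub>End_space n\<^esub> R_word n s w"
    using uw(1)
  proof (induction u)
    case Nil
    show ?case using cl[OF uw(2)] by (simp add: R_word_def)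
  next
    case (Cons g u)
    have "R_gen n s g \<in> carrier (End_space n)"
      using represents_R_gen[OF assms(1) _ assms(2)] Cons by (auto simp: represents_def)
    moreover have "R_word n s (g # v) = R_gen n s g \<otimes>\<^bsub>End_space n\<^esub> R_word n s v" for v
      by (simp add: R_word_def)
    ultimately show ?case
      using Cons cl[OF uw(2)] cl[of u] by (simp add: E.m_assoc)
  qed
  then show "R_word n s (u \<otimes>\<^bsub>free_monoid (blob_gens n)\<^esub> w) = R_word n s u \<otimes>\<^bsub>End_space n\<^esub> R_word n s w"
    by (simp add: free_monoid_def)
qed

text \<open>For \<open>i < n\<close> all first sites lie below \<open>2n\<close>, so no link of a
  \<open>GU\<close> crosses the seam between \<open>2n\<close> and \<open>-2n + 1\<close>; the link
  of weight \<open>w\<close> is the only one that does.\<close>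

lemma gen_links_GU:
  assumes "1 \<le> i" "i < n"
  shows "gen_links n s (GU i) =
    [(s Wa, - int n - int i, - int n - int i + 1), (s Wb, - int n + int i, - int n + int i + 1),
     (s Wc, int n - int i, int n - int i + 1), (s Wd, int n + int i, int n + int i + 1)]"
  using assms by (auto simp: next_pos_def)

lemma gen_links_Ge_Gf:
  assumes "1 \<le> n"
  shows "gen_links n s Ge = [(s Wx, - int n, - int n + 1), (s Wy, int n, int n + 1)]"
    "gen_links n s Gf = [(s Wz, 0, 1), (s Ww, 2 * int n, - 2 * int n + 1)]"
  using assms by (auto simp: next_pos_def)

section \<open>Relations that hold block by block\<close>

lemma distinct_sites_gen:
  assumes "1 \<le> n" "g \<in> blob_gens n"
  shows "distinct (sites (gen_links n s g))"
proof (cases g)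
  case (GU i)
  with assms have i: "1 \<le> i" "i < n" by (auto simp: blob_gens_def)
  then have "1 \<le> int i" "int i < int n" by auto
  then show ?thesis unfolding GU gen_links_GU[OF i] by auto
next
  case Ge
  have "1 \<le> int n" using assms by auto
  then show ?thesis unfolding Ge gen_links_Ge_Gf[OF assms(1)] by auto
next
  case Gf
  have "1 \<le> int n" using assms by auto
  then show ?thesis unfolding Gf gen_links_Ge_Gf[OF assms(1)] by auto
qed

lemma gen_links_nonzero: "(\<And>v. s v \<noteq> 0) \<Longrightarrow> 0 \<notin> fst ` set (gen_links n s g)"
  by (cases g) (auto simp: eq_commute[of 0])

lemma links_op_gen_idem:
  assumes "1 \<le> n" "g \<in> blob_gens n" "\<And>v. s v \<noteq> 0"
  shows "links_op (word_links n s [g, g]) f =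
    (\<lambda>\<beta>. (\<Prod>q\<leftarrow>map fst (gen_links n s g). q + 1 / q) * links_op (word_links n s [g]) f \<beta>)"
  using links_op_idem[OF distinct_sites_gen[OF assms(1,2)] gen_links_nonzero[OF assms(3)]] by simp

lemma links_op_gen_commute:
  assumes "1 \<le> n" "g \<in> blob_gens n" "h \<in> blob_gens n"
    "set (sites (gen_links n s g)) \<inter> set (sites (gen_links n s h)) = {}"
  shows "links_op (word_links n s [g, h]) f = links_op (word_links n s [h, g]) f"
  using links_op_commute[OF distinct_sites_gen[OF assms(1,2)] distinct_sites_gen[OF assms(1,3)] assms(4)] by simp

text \<open>As \<open>i\<close> grows, the links of weights \<open>b\<close> and \<open>d\<close>
  move to the right and those of \<open>a\<close> and \<open>c\<close> to the left, so both relative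
  positions occur. The factor 1 is written out to match the form of
  \<open>links_op_block\<close>.\<close>

lemma links_op_TL:
  fixes p p' :: int
  assumes "q \<noteq> 0" "\<bar>p - p'\<bar> = 1"
  shows "links_op ([(q, p, p + 1)] @ [(q, p', p' + 1)] @ [(q, p, p + 1)]) v =
    (\<lambda>\<beta>. 1 * links_op [(q, p, p + 1)] v \<beta>)"
proof -
  from assms(2) consider "p' = p + 1" | "p = p' + 1" by linarith
  then show ?thesis
    using assms(1) link_op_TL_left[of p "p + 1" "p + 2" q v] link_op_TL_right[of p' "p' + 1" "p' + 2" q v]
    by cases (simp_all add: add.assoc)
qed

lemma links_op_bridge:
  assumes "distinct [i, j, k, l]" "p \<noteq> 0" "q \<noteq> 0" "r \<noteq> 0"
  shows "links_op ([(p, i, j), (q, k, l)] @ [(r, j, k)] @ [(p, i, j), (q, k, l)]) v =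
    (\<lambda>\<beta>. (p * q / r + r / (p * q)) * links_op [(p, i, j), (q, k, l)] v \<beta>)"
  using link_op_bridge[OF assms, of v] by simp

lemma links_op_U_U_U:
  assumes "1 \<le> i" "i < n" "1 \<le> j" "j < n" "\<bar>int i - int j\<bar> = 1" and s: "\<And>v. s v \<noteq> 0"
  shows "links_op (word_links n s [GU i, GU j, GU i]) f = links_op (word_links n s [GU i]) f"
proof -
  define I J N where "I = int i" and "J = int j" and "N = int n"
  have b: "1 \<le> I" "I + 1 \<le> N" "1 \<le> J" "J + 1 \<le> N" "\<bar>I - J\<bar> = 1"
    using assms by (auto simp: I_def J_def N_def)
  then have IJ: "J = I + 1 \<or> J = I - 1" by auto
  let ?A = "\<lambda>k. [(s Wa, - N - k, - N - k + 1)]" and ?B = "\<lambda>k. [(s Wb, - N + k, - N + k + 1)]"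
    and ?C = "\<lambda>k. [(s Wc, N - k, N - k + 1)]" and ?D = "\<lambda>k. [(s Wd, N + k, N + k + 1)]"
  \<comment> \<open>The links of the four weights stay in four disjoint stretches of the ring, as
    \<open>i\<close> and \<open>j\<close> lie strictly between 0 and \<open>n\<close>; the stretches
    are joined one at a time, starting from the right.\<close>
  have CD: "links_op ((?C I @ ?D I) @ (?C J @ ?D J) @ (?C I @ ?D I)) v =
    (\<lambda>\<beta>. (1 * 1) * links_op (?C I @ ?D I) v \<beta>)" for v
    by (rule links_op_block; (rule links_op_TL)?) (use b IJ s in auto)
  have BCD: "links_op ((?B I @ ?C I @ ?D I) @ (?B J @ ?C J @ ?D J) @ (?B I @ ?C I @ ?D I)) v =
    (\<lambda>\<beta>. (1 * (1 * 1)) * links_op (?B I @ ?C I @ ?D I) v \<beta>)" for v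
    by (rule links_op_block; (rule links_op_TL CD)?) (use b IJ s in auto)
  have "links_op ((?A I @ ?B I @ ?C I @ ?D I) @ (?A J @ ?B J @ ?C J @ ?D J) @ (?A I @ ?B I @ ?C I @ ?D I)) f =
    (\<lambda>\<beta>. (1 * (1 * (1 * 1))) * links_op (?A I @ ?B I @ ?C I @ ?D I) f \<beta>)"
    by (rule links_op_block; (rule links_op_TL BCD)?) (use b IJ s in auto)
  then show ?thesis
    by (simp add: gen_links_GU[OF assms(1,2)] gen_links_GU[OF assms(3,4)] I_def J_def N_def del: gen_links.simps)
qed

text \<open>The links of \<open>a\<close> and \<open>b\<close> flank the link of \<open>x\<close> at
  \<open>-n\<close>, those of \<open>c\<close> and \<open>d\<close> flank the link of
  \<open>y\<close> at \<open>n\<close>: two separate bridges.\<close>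

lemma links_op_U_e_U:
  assumes "1 < n" and s: "\<And>v. s v \<noteq> 0"
  shows "links_op (word_links n s [GU 1, Ge, GU 1]) f =
    (\<lambda>\<beta>. ((s Wa * s Wb / s Wx + s Wx / (s Wa * s Wb)) * (s Wc * s Wd / s Wy + s Wy / (s Wc * s Wd))) *
      links_op (word_links n s [GU 1]) f \<beta>)"
proof -
  define N where "N = int n"
  have N: "N \<ge> 2" using assms by (simp add: N_def)
  let ?L1 = "[(s Wa, - N - 1, - N), (s Wb, - N + 1, - N + 2)]" and ?L2 = "[(s Wc, N - 1, N), (s Wd, N + 1, N + 2)]"
  have "links_op ((?L1 @ ?L2) @ ([(s Wx, - N, - N + 1)] @ [(s Wy, N, N + 1)]) @ (?L1 @ ?L2)) f =
    (\<lambda>\<beta>. ((s Wa * s Wb / s Wx + s Wx / (s Wa * s Wb)) * (s Wc * s Wd / s Wy + s Wy / (s Wc * s Wd))) *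
      links_op (?L1 @ ?L2) f \<beta>)"
    by (rule links_op_block; (rule links_op_bridge)?) (use N s in auto)
  moreover have "gen_links n s (GU 1) = ?L1 @ ?L2" "gen_links n s Ge = [(s Wx, - N, - N + 1)] @ [(s Wy, N, N + 1)]"
    using assms(1) by (auto simp: next_pos_def N_def)
  ultimately show ?thesis by (simp del: gen_links.simps)
qed

text \<open>One bridge lies across the seam: \<open>d\<close>, \<open>w\<close>, \<open>a\<close>
  follow each other around the ring there, while \<open>b\<close>, \<open>z\<close>,
  \<open>c\<close> do so around 0. The blocks are thus \<open>d, a\<close> and \<open>b, c\<close>,
  which calls for a reordering of the links of both generators.\<close>

lemma links_op_U_f_U:
  assumes "1 < n" and s: "\<And>v. s v \<noteq> 0"
  shows "links_op (word_links n s [GU (n - 1), Gf, GU (n - 1)]) f =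
    (\<lambda>\<beta>. ((s Wd * s Wa / s Ww + s Ww / (s Wd * s Wa)) * (s Wb * s Wc / s Wz + s Wz / (s Wb * s Wc))) *
      links_op (word_links n s [GU (n - 1)]) f \<beta>)"
proof -
  define N where "N = int n"
  have N: "N \<ge> 2" using assms by (simp add: N_def)
  let ?L1 = "[(s Wd, 2 * N - 1, 2 * N), (s Wa, - 2 * N + 1, - 2 * N + 2)]" and ?L2 = "[(s Wb, - 1, 0), (s Wc, 1, 2)]"
    and ?M1 = "[(s Ww, 2 * N, - 2 * N + 1)]" and ?M2 = "[(s Wz, 0, 1 :: int)]"
  have *: "links_op ((?L1 @ ?L2) @ (?M1 @ ?M2) @ (?L1 @ ?L2)) f =
    (\<lambda>\<beta>. ((s Wd * s Wa / s Ww + s Ww / (s Wd * s Wa)) * (s Wb * s Wc / s Wz + s Wz / (s Wb * s Wc))) *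
      links_op (?L1 @ ?L2) f \<beta>)"
    by (rule links_op_block; (rule links_op_bridge)?) (use N s in auto)
  have g: "gen_links n s (GU (n - 1)) = [(s Wa, - 2 * N + 1, - 2 * N + 2), (s Wb, - 1, 0), (s Wc, 1, 2), (s Wd, 2 * N - 1, 2 * N)]"
    "gen_links n s Gf = [(s Wz, 0, 1), (s Ww, 2 * N, - 2 * N + 1)]"
    using assms(1) by (auto simp: next_pos_def N_def of_nat_diff)
  have "links_op (gen_links n s (GU (n - 1))) v = links_op (?L1 @ ?L2) v" for v
    unfolding g by (rule links_op_perm) (use N in auto)
  moreover have "links_op (gen_links n s Gf) v = links_op (?M1 @ ?M2) v" for v
    unfolding g by (rule links_op_perm) (use N in auto)
  ultimately show ?thesis using * by (simp del: gen_links.simps)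
qed


section \<open>The two perfect matchings of the ring\<close>

definition parity_class :: "nat \<Rightarrow> bool \<Rightarrow> int set" where
  "parity_class n b = {p \<in> positions n. even p \<longleftrightarrow> b}"

lemma even_next_pos: "even (next_pos n p) \<longleftrightarrow> odd p"
  by (auto simp: next_pos_def)

lemma next_pos_inj: "p \<in> positions n \<Longrightarrow> p' \<in> positions n \<Longrightarrow> next_pos n p = next_pos n p' \<Longrightarrow> p = p'"
  by (auto simp: next_pos_def positions_def split: if_splits)

lemma next_pos_parity_class: "next_pos n ` parity_class n b = parity_class n (\<not> b)"
proof
  show "next_pos n ` parity_class n b \<subseteq> parity_class n (\<not> b)"
    using next_pos_in_positions even_next_pos by (auto simp: parity_class_def)
  show "parity_class n (\<not> b) \<subseteq> next_pos n ` parity_class n b"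
  proof
    fix p assume p: "p \<in> parity_class n (\<not> b)"
    define p' where "p' = (if p = - 2 * int n + 1 then 2 * int n else p - 1)"
    have "p = next_pos n p'" "p' \<in> parity_class n b"
      using p by (auto simp: p'_def next_pos_def parity_class_def positions_def)
    then show "p \<in> next_pos n ` parity_class n b" by blast
  qed
qed

text \<open>The links of I start at the sites of one parity, those of J at the sites of the other.
  The sites \<open>n\<close> and \<open>-n\<close> belong to \<open>e\<close>, the sites 0 and
  \<open>2n\<close> to \<open>f\<close>, and any other site to the \<open>U_i\<close> for which
  \<open>i\<close> is its distance to the nearer of \<open>n\<close> and \<open>-n\<close>.\<close>

lemma parity_class_eq:
  assumes "1 \<le> n"
  shows "parity_class n b =
    (\<Union>i\<in>{i\<in>{1..<n}. even (n + i) = b}. {- int n - int i, - int n + int i, int n - int i, int n + int i}) \<union>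
    (if even n = b then {- int n, int n} else {}) \<union> (if b then {0, 2 * int n} else {})" (is "?l = ?r")
proof
  show "?r \<subseteq> ?l"
    using assms by (auto simp: parity_class_def positions_def split: if_splits)
  show "?l \<subseteq> ?r"
  proof
    fix p assume "p \<in> ?l"
    then have p: "p \<ge> - 2 * int n + 1" "p \<le> 2 * int n" "even p \<longleftrightarrow> b"
      by (auto simp: parity_class_def positions_def)
    have *: "p \<in> ?r" if "p = - int n - i \<or> p = - int n + i \<or> p = int n - i \<or> p = int n + i" "1 \<le> i" "i < int n" for i
    proof -
      have "nat i \<in> {i \<in> {1..<n}. even (n + i) = b}"
        using that p(3) by (auto simp: even_nat_iff)
      moreover have "p \<in> {- int n - int (nat i), - int n + int (nat i), int n - int (nat i), int n + int (nat i)}"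
        using that by auto
      ultimately show ?thesis by (intro UnI1 UN_I)
    qed
    consider "p < - int n" | "p = - int n" | "- int n < p" "p < 0" | "p = 0" | "0 < p" "p < int n"
      | "p = int n" | "int n < p" "p < 2 * int n" | "p = 2 * int n" using p by linarith
    then show "p \<in> ?r"
    proof cases
      case 1 then show ?thesis using p by (intro *[of "- int n - p"]) auto
    next
      case 2 then show ?thesis using p by auto
    next
      case 3 then show ?thesis using p by (intro *[of "int n + p"]) auto
    next
      case 4 then show ?thesis using p by auto
    next
      case 5 then show ?thesis using p by (intro *[of "int n - p"]) auto
    next
      case 6 then show ?thesis using p by auto
    next
      case 7 then show ?thesis using p by (intro *[of "p - int n"]) auto
    next
      case 8 then show ?thesis using p by auto
    qed
  qed
qed

text \<open>Serves a counting argument: in a list of \<open>2 * n\<close> links whose first sites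
  fill the class, no first site repeats.\<close>

lemma card_parity_class: "card (parity_class n b) = 2 * n"
proof -
  have "parity_class n b = (\<lambda>k. 2 * k - (if b then 0 else 1)) ` {- int n + 1..int n}"
  proof (intro Set.set_eqI iffI)
    fix p assume p: "p \<in> parity_class n b"
    show "p \<in> (\<lambda>k. 2 * k - (if b then 0 else 1)) ` {- int n + 1..int n}"
    proof (cases b)
      case True
      with p obtain k where "p = 2 * k" by (auto simp: parity_class_def elim: evenE)
      with True p show ?thesis by (intro image_eqI[of _ _ k]) (auto simp: parity_class_def positions_def)
    next
      case False
      with p obtain k where "p = 2 * k + 1" by (auto simp: parity_class_def elim: oddE)
      with False p show ?thesis by (intro image_eqI[of _ _ "k + 1"]) (auto simp: parity_class_def positions_def)
    qed
  qed (auto simp: parity_class_def positions_def split: if_splits)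
  then show ?thesis by (simp add: card_image inj_on_def)
qed

text \<open>The first sites are distinct by counting, the second ones by injectivity of
  \<open>next_pos\<close>. The two kinds never meet since they differ in parity, even across the
  seam, where \<open>2n\<close> is followed by the odd number \<open>-2n + 1\<close>.\<close>

lemma sites_parity_class:
  assumes nx: "\<forall>(q, i, j) \<in> set L. j = next_pos n i"
    and pos: "(\<lambda>(q, i, j). i) ` set L = parity_class n b" and len: "length L = 2 * n"
  shows "distinct (sites L)" "set (sites L) = positions n"
proof -
  have dist: "distinct (map (\<lambda>(q, i, j). i) L)"
    using pos len card_parity_class[of n b] by (intro card_distinct) simp
  have "distinct (sites M)"
    if "distinct (map (\<lambda>(q, i, j). i) M)" "\<forall>(q, i, j) \<in> set M. j = next_pos n i \<and> i \<in> parity_class n b" for M :: "('a, int) link list"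
    using that
  proof (induction M)
    case (Cons x M)
    obtain q i j where x [simp]: "x = (q, i, j)" by (cases x)
    have "k \<noteq> i \<and> k \<noteq> j" if "k \<in> set (sites M)" for k
    proof -
      obtain q' i' j' where M: "(q', i', j') \<in> set M" "k = i' \<or> k = j'"
        using \<open>k \<in> _\<close> by (auto simp: sites_def)
      then have "i' \<noteq> i" "j' = next_pos n i'" "i' \<in> parity_class n b" "j = next_pos n i" "i \<in> parity_class n b"
        using Cons.prems by force+
      then show ?thesis
        using M(2) even_next_pos[of n i] even_next_pos[of n i'] next_pos_inj[of i n i']
        by (auto simp: parity_class_def)
    qed
    moreover have "i \<noteq> j" using Cons.prems(2) even_next_pos[of n i] by auto
    ultimately show ?case using Cons by auto
  qed simp
  moreover have "\<forall>(q, i, j) \<in> set L. j = next_pos n i \<and> i \<in> parity_class n b"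
    using nx unfolding pos[symmetric] by force
  ultimately show "distinct (sites L)" using dist by blast
  have "set (sites L) = (\<lambda>(q, i, j). i) ` set L \<union> (\<lambda>(q, i, j). j) ` set L"
    by (force simp: sites_def)
  also have "(\<lambda>(q, i, j). j) ` set L = next_pos n ` (\<lambda>(q, i, j). i) ` set L"
    using nx by (force simp: image_iff)
  finally show "set (sites L) = positions n"
    unfolding pos next_pos_parity_class by (auto simp: parity_class_def)
qed

text \<open>Starting at the left end, each spin determines the next one. Conversely, the parity
  patterns close up at the seam because the ring has an even number of sites. The parameter
  \<open>b\<close> only decides which pattern is named first.\<close>

lemma alternating_iff:
  assumes "1 \<le> n"
  shows "(\<forall>p\<in>positions n. \<alpha> p \<noteq> \<alpha> (next_pos n p)) \<longleftrightarrow>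
    (\<forall>p\<in>positions n. \<alpha> p = (even p = b)) \<or> (\<forall>p\<in>positions n. \<alpha> p = (\<not> (even p = b)))" (is "?l \<longleftrightarrow> ?r")
proof
  assume ?l
  let ?s = "- 2 * int n + 1"
  define c where "c = \<alpha> ?s"
  have chain: "p \<le> 2 * int n \<longrightarrow> \<alpha> p = (odd p = c)" if "?s \<le> p" for p
    using that
  proof (induction p rule: int_ge_induct)
    case (step p)
    show ?case
    proof
      assume "p + 1 \<le> 2 * int n"
      then have "p \<in> positions n" "next_pos n p = p + 1" "p \<le> 2 * int n"
        using step.hyps by (auto simp: positions_def next_pos_def)
      then have "\<alpha> p \<noteq> \<alpha> (p + 1)" "\<alpha> p = (odd p = c)"
        using step.IH \<open>?l\<close> by force+
      then show "\<alpha> (p + 1) = (odd (p + 1) = c)" using even_plus_one_iff[of p] by argo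
    qed
  qed (simp add: c_def)
  have "\<alpha> p = (odd p = c)" if "p \<in> positions n" for p
    using chain[of p] that by (simp add: positions_def)
  then show ?r by (cases "c = (\<not> b)") auto
next
  assume ?r
  show ?l
  proof
    fix p assume p: "p \<in> positions n"
    then have "\<alpha> p = (even p = b) \<and> \<alpha> (next_pos n p) = (even (next_pos n p) = b) \<or>
      \<alpha> p = (\<not> (even p = b)) \<and> \<alpha> (next_pos n p) = (\<not> (even (next_pos n p) = b))"
      using \<open>?r\<close> next_pos_in_positions[OF p] by blast
    then show "\<alpha> p \<noteq> \<alpha> (next_pos n p)" using even_next_pos[of n p] by argo
  qed
qed

lemma length_filter_parity:
  "length (filter odd [1..<n]) = n div 2" "length (filter even [1..<n]) = (n - 1) div 2"
proof -
  have "length (filter odd [1..<n]) = n div 2 \<and> length (filter even [1..<n]) = (n - 1) div 2"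
    by (induction n) (auto simp: upt_Suc elim!: oddE evenE)
  then show "length (filter odd [1..<n]) = n div 2" "length (filter even [1..<n]) = (n - 1) div 2" by auto
qed

lemma gen_links_next: "\<forall>(q, i, j) \<in> set (gen_links n s g). j = next_pos n i"
  by (cases g) auto

lemma length_word_links_GU: "length (word_links n s (map GU xs)) = 4 * length xs"
  by (induction xs) auto

lemma prod_word_links_GU:
  "prod_list (map fst (word_links n s (map GU xs))) = (s Wa * s Wb * s Wc * s Wd) ^ length xs"
  by (induction xs) (auto simp: mult_ac)

lemma word_in_lists:
  assumes "1 \<le> n"
  shows "word_I n \<in> lists (blob_gens n)" "word_J n \<in> lists (blob_gens n)"
  by (auto simp: word_I_def word_J_def blob_gens_def)

lemma links_op_I_J:
  fixes s :: "weight \<Rightarrow> 'k::field"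
  assumes n: "1 \<le> n" and s: "\<And>v. s v \<noteq> 0"
  defines "I \<equiv> word_links n s (word_I n)" and "J \<equiv> word_links n s (word_J n)"
    and "K \<equiv> weight_eval s (theta_val n PK)"
  shows "links_op I (links_op J (links_op I v)) = (\<lambda>\<beta>. K * links_op I v \<beta>)"
    and "links_op J (links_op I (links_op J v)) = (\<lambda>\<beta>. K * links_op J v \<beta>)"
proof -
  have nx: "\<forall>(q, i, j) \<in> set I. j = next_pos n i" "\<forall>(q, i, j) \<in> set J. j = next_pos n i"
    using gen_links_next[of n s] by (fastforce simp: I_def J_def)+
  have pos: "(\<lambda>(q, i, j). i) ` set I = parity_class n (odd n)" "(\<lambda>(q, i, j). i) ` set J = parity_class n (even n)"
    unfolding parity_class_eq[OF n] I_def J_def word_I_def word_J_def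
    by (auto simp: image_UN)
  have len: "length I = 2 * n" "length J = 2 * n"
    using n length_word_links_GU[of n s]
    by (auto simp: I_def J_def word_I_def word_J_def length_filter_parity[unfolded One_nat_def]; presburger)+
  let ?q = "s Wa * s Wb * s Wc * s Wd"
  have prodI: "prod_list (map fst I) = ?q ^ (n div 2) * (if odd n then s Wz * s Ww else 1)"
    using prod_word_links_GU[of n s] by (simp add: I_def word_I_def length_filter_parity[unfolded One_nat_def])
  have prodJ: "prod_list (map fst J) = s Wx * s Wy * ?q ^ ((n - 1) div 2) * (if even n then s Wz * s Ww else 1)"
    using prod_word_links_GU[of n s] by (simp add: J_def word_J_def length_filter_parity[unfolded One_nat_def])
  have nz: "prod_list (map fst I) \<noteq> 0" "prod_list (map fst J) \<noteq> 0"
    by (simp_all add: prodI prodJ s)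
  define t where "t = prod_list (map fst I) / prod_list (map fst J)"
  \<comment> \<open>For odd \<open>n\<close> both words contain equally many \<open>U_i\<close>, so
    \<open>abcd\<close> cancels; for even \<open>n\<close> the word I has one more. In the odd case
    \<open>t\<close> is the inverse of the first summand in \<open>theta_val n PK\<close>, and the
    expression is symmetric under inversion.\<close>
  have K: "t + 2 + 1 / t = K"
  proof (cases "odd n")
    case True
    then have "t = s Wz * s Ww / (s Wx * s Wy)"
      using s by (auto simp: t_def prodI prodJ elim!: oddE)
    then show ?thesis
      using True by (simp add: K_def weight_eval_add weight_eval_mult[OF s] weight_eval_simps)
  next
    case False
    then obtain m where "n = 2 * m" by (auto elim: evenE)
    \<comment> \<open>Since \<open>n\<close> is positive, the half of \<open>n\<close> can be
      shifted by one, which makes both halvings in the exponents explicit.\<close>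
    with n obtain m where m: "n = Suc (Suc (2 * m))" by (cases m) auto
    have "t = ?q / (s Wx * s Wy * s Wz * s Ww)"
      using s by (simp add: t_def prodI prodJ m mult_ac)
    then show ?thesis
      using False by (simp add: K_def weight_eval_add weight_eval_mult[OF s] weight_eval_simps mult_ac)
  qed
  note sI = sites_parity_class[OF nx(1) pos(1) len(1)]
  note sJ = sites_parity_class[OF nx(2) pos(2) len(2)]
  \<comment> \<open>\<open>True\<close> on the parity class in which the links of I start, hence at
    the first site of each link of I and at the second site of each link of J.\<close>
  let ?\<tau> = "\<lambda>p::int. even p = odd n"
  have \<tau>: "(\<forall>(q, i, j) \<in> set I \<union> set J. \<alpha> i \<noteq> \<alpha> j) \<longleftrightarrow>
      (\<forall>p\<in>set (sites I). \<alpha> p = ?\<tau> p) \<or> (\<forall>p\<in>set (sites I). \<alpha> p = (\<not> ?\<tau> p))" for \<alpha>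
  proof -
    have one: "(\<forall>(q, i, j) \<in> set M. \<alpha> i \<noteq> \<alpha> j) \<longleftrightarrow>
      (\<forall>p\<in>(\<lambda>(q, i, j). i) ` set M. \<alpha> p \<noteq> \<alpha> (next_pos n p))"
      if "\<forall>(q, i, j) \<in> set M. j = next_pos n i" for M :: "('k, int) link list"
      using that unfolding ball_simps case_prod_unfold by (intro ball_cong refl) simp
    have "(\<forall>(q, i, j) \<in> set I \<union> set J. \<alpha> i \<noteq> \<alpha> j) \<longleftrightarrow>
      (\<forall>p\<in>(\<lambda>(q, i, j). i) ` set I \<union> (\<lambda>(q, i, j). i) ` set J. \<alpha> p \<noteq> \<alpha> (next_pos n p))"
      by (simp only: ball_Un one[OF nx(1)] one[OF nx(2)])
    also have "(\<lambda>(q, i, j). i) ` set I \<union> (\<lambda>(q, i, j). i) ` set J = positions n"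
      unfolding pos by (auto simp: parity_class_def)
    finally show ?thesis unfolding sI(2) alternating_iff[OF n, of \<alpha> "odd n"] .
  qed
  have \<tau>I: "\<forall>(q, i, j) \<in> set I. ?\<tau> i \<and> \<not> ?\<tau> j"
  proof clarify
    fix q i j assume "(q, i, j) \<in> set I"
    then have "j = next_pos n i" "i \<in> parity_class n (odd n)" using nx(1) pos(1) by force+
    then show "?\<tau> i \<and> \<not> ?\<tau> j" using even_next_pos[of n i] by (auto simp: parity_class_def)
  qed
  have \<tau>J: "\<forall>(q, i, j) \<in> set J. \<not> ?\<tau> i \<and> ?\<tau> j"
  proof clarify
    fix q i j assume "(q, i, j) \<in> set J"
    then have "j = next_pos n i" "i \<in> parity_class n (even n)" using nx(2) pos(2) by force+
    then show "\<not> ?\<tau> i \<and> ?\<tau> j" using even_next_pos[of n i] by (auto simp: parity_class_def)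
  qed
  have "set (sites I) = set (sites J)" "I \<noteq> []" using sI sJ len n by auto
  note sandwich = links_op_sandwich[OF sI(1) sJ(1) this \<tau> \<tau>I \<tau>J nz, folded t_def, unfolded K]
  show "links_op I (links_op J (links_op I v)) = (\<lambda>\<beta>. K * links_op I v \<beta>)"
    "links_op J (links_op I (links_op J v)) = (\<lambda>\<beta>. K * links_op J v \<beta>)"
    by (rule sandwich)+
qed

section \<open>All defining relations and the representation of the algebra\<close>

lemma word_links_relation:
  fixes s :: "weight \<Rightarrow> 'k::field"
  assumes n: "1 \<le> n" and s: "\<And>v. s v \<noteq> 0" and uv: "(u, c, v) \<in> blob_relations n"
  shows "links_op (word_links n s u) f = (\<lambda>\<beta>. weight_eval s (theta n c) * links_op (word_links n s v) f \<beta>)"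
proof -
  note ev = theta_def param_eval_var param_eval_1 weight_eval_add weight_eval_mult[OF s] weight_eval_simps
  have GU: "GU i \<in> blob_gens n" if "i \<in> {1..<n}" for i using that by (auto simp: blob_gens_def)
  have G: "Ge \<in> blob_gens n" "Gf \<in> blob_gens n" by (auto simp: blob_gens_def)
  show ?thesis
    using uv
  proof cases
    case (1 i)
    then show ?thesis
      using links_op_gen_idem[of n "GU i" s f, OF n GU s] by (simp add: ev mult_ac)
  next
    case (2 i j)
    then show ?thesis
      using links_op_U_U_U[of i n j s f] s by (simp add: ev)
  next
    case (3 i j)
    have "links_op (word_links n s [GU i, GU j]) f = links_op (word_links n s [GU j, GU i]) f"
    \<comment> \<open>The relation also covers \<open>i = j\<close>, where the links coincide
      instead of being disjoint and both words are the same.\<close>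
    proof (cases "i = j")
      case False
      then have "set (sites (gen_links n s (GU i))) \<inter> set (sites (gen_links n s (GU j))) = {}"
        using 3 gen_links_GU[of i n s] gen_links_GU[of j n s] by (auto simp del: gen_links.simps)
      then show ?thesis using 3 GU by (intro links_op_gen_commute n)
    qed simp
    with 3 show ?thesis by (simp add: ev)
  next
    case 4
    then show ?thesis
      using links_op_gen_idem[of n Ge s f, OF n G(1) s] by (simp add: ev mult_ac)
  next
    case 5
    then show ?thesis
      using links_op_gen_idem[of n Gf s f, OF n G(2) s] by (simp add: ev mult_ac)
  next
    case 6
    then show ?thesis
      using links_op_U_e_U[of n s f] s by (simp add: ev)
  next
    case 7
    then show ?thesis
      using links_op_U_f_U[of n s f] s by (simp add: ev mult_ac)
  next
    case (8 i)
    have "set (sites (gen_links n s Ge)) \<inter> set (sites (gen_links n s (GU i))) = {}"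
      using 8 gen_links_GU[of i n s] gen_links_Ge_Gf[OF n, of s] by (auto simp del: gen_links.simps)
    then have "links_op (word_links n s [Ge, GU i]) f = links_op (word_links n s [GU i, Ge]) f"
      using 8 GU G by (intro links_op_gen_commute n)
    with 8 show ?thesis by (simp add: ev)
  next
    case (9 i)
    have "set (sites (gen_links n s Gf)) \<inter> set (sites (gen_links n s (GU i))) = {}"
      using 9 gen_links_GU[of i n s] gen_links_Ge_Gf[OF n, of s] by (auto simp del: gen_links.simps)
    then have "links_op (word_links n s [Gf, GU i]) f = links_op (word_links n s [GU i, Gf]) f"
      using 9 GU G by (intro links_op_gen_commute n)
    with 9 show ?thesis by (simp add: ev)
  next
    case 10
    have "set (sites (gen_links n s Ge)) \<inter> set (sites (gen_links n s Gf)) = {}"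
      using 10 gen_links_Ge_Gf[OF n, of s] by (auto simp del: gen_links.simps)
    then have "links_op (word_links n s [Ge, Gf]) f = links_op (word_links n s [Gf, Ge]) f"
      using G by (intro links_op_gen_commute n)
    with 10 show ?thesis by (simp add: ev)
  next
    case 11
    then show ?thesis using links_op_I_J(1)[of n s f, OF n s] by (simp add: theta_def param_eval_var)
  next
    case 12
    then show ?thesis using links_op_I_J(2)[of n s f, OF n s] by (simp add: theta_def param_eval_var)
  qed
qed

lemma blob_relations_words:
  assumes "1 \<le> n" "(u, c, v) \<in> blob_relations n"
  shows "u \<in> lists (blob_gens n)" "v \<in> lists (blob_gens n)"
  by (use assms(2) in cases; use word_in_lists[OF assms(1)] in \<open>auto simp: blob_gens_def\<close>)+

theorem proposition3p2:
  fixes n :: nat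
    and pars :: "param \<Rightarrow> 'k::alg_closed_field"
    and \<rho> :: "param_ring \<Rightarrow> 'k"
  assumes "n \<ge> 1"
    and "\<rho> = param_eval pars"
  shows "\<exists>wts :: weight \<Rightarrow> 'k.
           (\<forall>v. wts v \<noteq> 0) \<and>
           \<rho> = weight_eval wts \<circ> theta n \<and>
           (\<exists>\<phi> \<in> algebra_hom (scalar_extension \<rho> (blob_algebra n)) (End_space n).
              \<forall>g\<in>blob_gens n.
                \<phi> (tensor_elem \<rho> (blob_algebra n) 1 (blob_elem n g)) = R_gen n wts g)"
proof -
  obtain wts :: "weight \<Rightarrow> 'k" where wts: "\<And>v. wts v \<noteq> 0" "\<And>v. weight_eval wts (theta_val n v) = pars v"
    using ex_weights[of n pars] by blast
  have \<rho>: "\<rho> = weight_eval wts \<circ> theta n"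
    by (simp add: assms(2) fun_eq_iff theta_def weight_eval_param_eval[OF wts(1)] wts(2))
  define F where "F = (free_algebra (blob_gens n) :: (param_ring, blob_gen list \<Rightarrow>\<^sub>0 param_ring) module)"
  have F: "F = monoid_algebra (free_monoid (blob_gens n))" by (simp add: F_def free_algebra_def)
  have single: "Poly_Mapping.single w c \<in> carrier F" if "w \<in> lists (blob_gens n)" for w c
    using that by (auto simp: F monoid_algebra_simps free_monoid_def)
  interpret R: monoid_rep "free_monoid (blob_gens n)" \<rho> n "R_word n wts"
    unfolding assms(2) by (rule monoid_rep_R_word[OF assms(1) wts(1) scalar_hom_param_eval])
  have relators: "blob_relators n \<subseteq> carrier (monoid_algebra (free_monoid (blob_gens n)))"
  proof
    fix p assume "p \<in> blob_relators n"
    then obtain u c v where ucv: "(u, c, v) \<in> blob_relations n"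
      "p = Poly_Mapping.single u 1 - Poly_Mapping.single v c" by (auto simp: blob_relators_def)
    note w = blob_relations_words[OF assms(1) ucv(1)]
    show "p \<in> carrier (monoid_algebra (free_monoid (blob_gens n)))"
      using w keys_diff[of "Poly_Mapping.single u 1" "Poly_Mapping.single v c"]
      by (auto simp: ucv monoid_algebra_simps free_monoid_def split: if_splits)
  qed
  have zero: "R.ext p = \<zero>\<^bsub>End_space n\<^esub>" if "p \<in> blob_relators n" for p
  proof -
    obtain u c v where ucv: "(u, c, v) \<in> blob_relations n"
      "p = Poly_Mapping.single u 1 - Poly_Mapping.single v c"
      using \<open>p \<in> _\<close> by (auto simp: blob_relators_def)
    note w = blob_relations_words[OF assms(1) ucv(1)]
    note rep = represents_R_word[of n wts, OF assms(1) wts(1) w(1)] represents_R_word[of n wts, OF assms(1) wts(1) w(2)]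
    \<comment> \<open>Checked in coordinates, where the constant of the relation appears as
      \<open>weight_eval wts (theta n c)\<close>; the factorisation of \<open>\<rho>\<close>
      identifies it with \<open>\<rho> c\<close>.\<close>
    have "R_word n wts u x = scale (\<rho> c) (R_word n wts v x)" if x: "x \<in> tensor_space n" for x
    proof (rule coord_eqI)
      show "R_word n wts u x \<in> tensor_space n" "scale (\<rho> c) (R_word n wts v x) \<in> tensor_space n"
        using rep x by (auto simp: represents_def End_space_iff intro!: tensor_space_closed)
      show "coord n (R_word n wts u x) = coord n (scale (\<rho> c) (R_word n wts v x))"
        using rep x word_links_relation[of n wts, OF assms(1) wts(1) ucv(1), of "coord n x"]
        by (simp add: represents_def fun_eq_iff coord_scale \<rho>)
    qed
    then show ?thesis
      by (intro R.ext_eq_zeroI) (simp add: ucv(2) R.ext_diff R.ext_single R.hom_one)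
  qed
  have blob: "blob_algebra n = quot_algebra F (blob_relators n)" by (simp add: blob_algebra_def F_def)
  obtain \<phi> where \<phi>: "\<phi> \<in> ring_hom (blob_algebra n) (End_space n)"
    "\<And>p. p \<in> carrier F \<Longrightarrow> \<phi> (Idl\<^bsub>F\<^esub> (blob_relators n) +>\<^bsub>F\<^esub> p) = R.ext p"
    "\<And>c X. X \<in> carrier (blob_algebra n) \<Longrightarrow> c \<odot>\<^bsub>blob_algebra n\<^esub> X \<in> carrier (blob_algebra n)"
    "\<And>c X. X \<in> carrier (blob_algebra n) \<Longrightarrow> \<phi> (c \<odot>\<^bsub>blob_algebra n\<^esub> X) = \<rho> c \<odot>\<^bsub>End_space n\<^esub> \<phi> X"
    unfolding blob by (rule R.quot_algebra_rep[OF relators zero, folded F]) (assumption, rule that[unfolded blob])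
  have rF: "ring F" unfolding F by (rule ring_monoid_algebra[OF monoid_free_monoid])
  have rB: "ring (blob_algebra n)"
    unfolding blob_algebra_def using relators rF by (intro ring_quot_algebra) (simp_all add: F free_algebra_def)
  obtain \<psi> where \<psi>: "\<psi> \<in> algebra_hom (scalar_extension \<rho> (blob_algebra n)) (End_space n)"
    "\<And>x b. b \<in> carrier (blob_algebra n) \<Longrightarrow> \<psi> (tensor_elem \<rho> (blob_algebra n) x b) = x \<odot>\<^bsub>End_space n\<^esub> \<phi> b"
    by (rule scalar_extension_rep[OF rB \<phi>(1,3,4)]) (assumption, assumption, rule that)
  have "\<psi> (tensor_elem \<rho> (blob_algebra n) 1 (blob_elem n g)) = R_gen n wts g" if g: "g \<in> blob_gens n" for g
  proof -
    interpret F: ring F by (rule rF)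
    interpret I: ideal "Idl\<^bsub>F\<^esub> (blob_relators n)" F using relators by (intro F.genideal_ideal) (simp add: F)
    have T: "R_gen n wts g \<in> carrier (End_space n)"
      using represents_R_gen[of n g wts, OF assms(1) g wts(1)] by (simp add: represents_def)
    interpret c: ring_hom_ring F "F Quot Idl\<^bsub>F\<^esub> (blob_relators n)" "(+>\<^bsub>F\<^esub>) (Idl\<^bsub>F\<^esub> (blob_relators n))"
      by (rule I.rcos_ring_hom_ring)
    have gF: "Poly_Mapping.single [g] 1 \<in> carrier F" using g by (intro single) auto
    have elem: "blob_elem n g = Idl\<^bsub>F\<^esub> (blob_relators n) +>\<^bsub>F\<^esub> Poly_Mapping.single [g] 1"
      by (simp add: blob_elem_def F_def Let_def)
    have "blob_elem n g \<in> carrier (blob_algebra n)"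
      unfolding elem using c.hom_closed[OF gF] by (simp add: blob_algebra_def F_def)
    then have "\<psi> (tensor_elem \<rho> (blob_algebra n) 1 (blob_elem n g)) =
        1 \<odot>\<^bsub>End_space n\<^esub> R.ext (Poly_Mapping.single [g] 1)"
      using \<psi>(2) \<phi>(2)[OF gF] by (simp add: elem)
    also have "\<dots> = R_gen n wts g"
      using T unfolding End_space_simps
      by (intro extensionalityI[of _ "tensor_space n"])
        (auto simp: End_space_iff R.ext_single R.hom_one R_word_def End_space_simps compose_def)
    finally show ?thesis .
  qed
  with \<psi>(1) \<rho> wts(1) show ?thesis by blast
qed

end
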